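(* Let $L(\partial)=\partial_t+\sum_{l=1}^dA_l\partial_l$ be a hyperbolic operator with constant $N\times N$ matrices, nondegenerate with respect to $x_1$. Let $\sigma^-,\sigma^+$ be real constants and suppose that the Bérenger split operators $\widetilde L_1+\widetilde B^-$ and $\widetilde L_1+\widetilde B^+$ are both weakly hyperbolic. Then the transmission problem $$(\widetilde L_1+\widetilde B^{\pm})\,\widetilde W^\pm=0\ \text{ in }\ \{\pm x_1>0\},\qquad \widetilde A_1\big(\widetilde W^+-\widetilde W^-\big)=\widetilde g\ \text{ on }\ \{x_1=0\}$$ ($\widetilde g$ valued in $\mathrm{Range}\,\widetilde A_1$), which corresponds to the absorptions $\sigma_j\equiv0$ for $j\ge2$ and $\sigma_1(x_1)=\sigma^\pm$ for $\pm x_1>0$, satisfies Hersh's condition: there is $\tau_0$ such that for all $\mathrm{Re}\,\tau>\tau_0$ and $\eta\in\mathbb R^{d-1}$, $$\mathcal N\oplus\big(\dot E^-_{\widetilde L}(\tau,\eta,\sigma^-)\times\dot E^+_{\widetilde L}(\tau,\eta,\sigma^+)\big)=\mathbb C^{dN}\times\mathbb C^{dN},\qquad \mathcal N:=\{(w^-,w^+):\ \widetilde A_1w^-=\widetilde A_1w^+\}.$$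
   Context: Split operators: for $\widetilde W=(W_1,\dots,W_d)$ with $W_l$ valued in $\mathbb C^N$, $(\widetilde L_1\widetilde W)_l=\partial_tW_l+A_l\partial_l(\sum_jW_j)$; $\widetilde B^\pm=\mathrm{diag}(\sigma^\pm I_N,0,\dots,0)$. $\widetilde A_1$ is the coefficient of $\partial_1$ in $\widetilde L_1$: $\widetilde A_1(w_1,\dots,w_d)=(A_1\sum_jw_j,0,\dots,0)$. (Weakly) hyperbolic (Gårding): a constant coefficient operator $\mathcal L$ is weakly hyperbolic when there is $m$ such that $\det\mathcal L(\tau,i\xi)=0$, $\xi\in\mathbb R^d$, implies $|\mathrm{Re}\,\tau|\le m$ (replace $\partial_t\to\tau$, $\partial_x\to i\xi$). For the homogeneous operator $L$ this says that $\sum_l\xi_lA_l$ has only real eigenvalues for $\xi\in\mathbb R^d$. Nondegenerate with respect to $x_1$: there is $\tau_1>0$ such that the degree in $\rho$ of the polynomial $\det L(\tau,\rho,i\eta)$ is independent of $(\tau,\eta)$ for $\mathrm{Re}\,\tau>\tau_1$, $\eta\in\mathbb R^{d-1}$. $\dot E^\pm_{\widetilde L}(\tau,\eta,\sigma)\subset\mathbb C^{dN}$ is the space of values at $x_1=0$ of those solutions on $\mathbb R$ of the ordinary differential equation $\widetilde L(\tau,d/dx_1,i\eta)Z=0$ that tend to zero as $x_1\to\pm\infty$, where $\widetilde L=\widetilde L_1+\mathrm{diag}(\sigma I_N,0,\dots,0)$.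
   Formalization: It is additionally assumed that ker A_1^2 = ker A_1 (0 is a semisimple eigenvalue of A_1); without it the claim fails, e.g. N=2, A_1 a nilpotent Jordan block and all other A_l=0, and the condition is necessary for the direct sum. *)

theory Defs
  imports "HOL-Analysis.Analysis" "HOL-Computational_Algebra.Computational_Algebra"
begin

text \<open>
  A first order constant coefficient operator \<open>\<partial>\<^sub>t + (\<Sum>l. C l \<partial>\<^sub>l) + B\<close> is given by its coefficient
  matrices \<open>C\<close>, indexed by the space variables \<open>'d\<close>, and its zero order term \<open>B\<close>.  One variable
  \<open>e :: 'd\<close> is singled out and plays the role of \<open>x\<^sub>1\<close>.  The space of tangential frequencies, of
  dimension \<open>CARD('d) - 1\<close>, is the coordinate hyperplane \<open>tangential e\<close>.

  The symbol is polymorphic in the ring so that \<open>\<partial>\<^sub>1\<close> can be replaced by a complex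
  number as well as by the polynomial indeterminate.
\<close>

definition symbol ::
    "('d::finite \<Rightarrow> ('a::comm_ring_1)^'m^'m) \<Rightarrow> 'a^'m^'m \<Rightarrow> 'a \<Rightarrow> 'a^'d \<Rightarrow> 'a^'m^'m" where
  "symbol C B \<tau> \<zeta> = mat \<tau> + (\<Sum>l\<in>UNIV. mat (\<zeta> $ l) ** C l) + B"

definition weakly_hyperbolic ::
    "('d::finite \<Rightarrow> complex^'m^'m) \<Rightarrow> complex^'m^'m \<Rightarrow> bool" where
  "weakly_hyperbolic C B \<longleftrightarrow>
     (\<exists>m::real. \<forall>\<tau> (\<xi>::real^'d).
        det (symbol C B \<tau> (\<chi> l. \<i> * complex_of_real (\<xi> $ l))) = 0 \<longrightarrow> \<bar>Re \<tau>\<bar> \<le> m)"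

definition tangential :: "'d::finite \<Rightarrow> (real^'d) set" where
  "tangential e = {\<eta>. \<eta> $ e = 0}"

definition normal_poly ::
    "('d::finite \<Rightarrow> complex^'m^'m) \<Rightarrow> complex^'m^'m \<Rightarrow> 'd \<Rightarrow> complex \<Rightarrow> real^'d \<Rightarrow> complex poly" where
  "normal_poly C B e \<tau> \<eta> =
     det (symbol (\<lambda>l. map_matrix (\<lambda>c. [:c:]) (C l)) (map_matrix (\<lambda>c. [:c:]) B) [:\<tau>:]
           (\<chi> l. if l = e then [:0, 1:] else [:\<i> * complex_of_real (\<eta> $ l):]))"

definition nondegenerate :: "('d::finite \<Rightarrow> complex^'m^'m) \<Rightarrow> complex^'m^'m \<Rightarrow> 'd \<Rightarrow> bool" where
  "nondegenerate C B e \<longleftrightarrow>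
     (\<exists>\<tau>\<^sub>1>0. \<exists>k. \<forall>\<tau>. \<forall>\<eta>\<in>tangential e. Re \<tau> > \<tau>\<^sub>1 \<longrightarrow> degree (normal_poly C B e \<tau> \<eta>) = k)"

text \<open>
  Values at \<open>0\<close> of the solutions on the whole line of the equation obtained by replacing \<open>\<partial>\<^sub>t\<close> by \<open>\<tau>\<close>,
  the tangential derivatives by \<open>\<i> \<eta>\<close> and \<open>\<partial>\<^sub>1\<close> by \<open>d/dx\<close>, and which tend to zero along the filter \<open>F\<close>,
  to be taken as \<open>at_top\<close> or \<open>at_bot\<close>.
  The matrix \<open>C e\<close> may be singular.  As \<open>\<eta> $ e = 0\<close>, the symbol below has no term in \<open>C e\<close>.
\<close>

definition decaying_values ::
    "real filter \<Rightarrow> ('d::finite \<Rightarrow> complex^'m^'m) \<Rightarrow> complex^'m^'m \<Rightarrow> 'd \<Rightarrow> complex \<Rightarrow> real^'d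
      \<Rightarrow> (complex^'m) set" where
  "decaying_values F C B e \<tau> \<eta> =
     {Z 0 | Z Z' :: real \<Rightarrow> complex^'m.
        (\<forall>x. (Z has_vector_derivative Z' x) (at x)) \<and>
        (\<forall>x. C e *v Z' x + symbol C B \<tau> (\<chi> l. \<i> * complex_of_real (\<eta> $ l)) *v Z x = 0) \<and>
        (Z \<longlongrightarrow> 0) F}"

text \<open>
  The split operators act on \<open>C\<^sup>d\<^sup>N\<close>, realised as \<open>complex^('d \<times> 'n)\<close>: entry \<open>(l, a)\<close> is the
  component \<open>a\<close> of the block \<open>W\<^sub>l\<close>.
\<close>

definition split_coeff ::
    "('d::finite \<Rightarrow> complex^'n^'n) \<Rightarrow> 'd \<Rightarrow> complex^('d \<times> 'n)^('d \<times> 'n)" where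
  "split_coeff A l = (\<chi> p q. if fst p = l then A l $ snd p $ snd q else 0)"

definition absorption :: "'d::finite \<Rightarrow> real \<Rightarrow> complex^('d \<times> 'n::finite)^('d \<times> 'n)" where
  "absorption e \<sigma> = (\<chi> p q. if p = q \<and> fst p = e then complex_of_real \<sigma> else 0)"

definition block_sum :: "complex^('d::finite \<times> 'n::finite) \<Rightarrow> complex^'n" where
  "block_sum w = (\<Sum>j\<in>UNIV. \<chi> a. w $ (j, a))"

lemma split_coeff_mult:
  "(split_coeff A l *v w) $ (k, a) = (if k = l then (A l *v block_sum w) $ a else 0)"
proof -
  have "(\<Sum>q\<in>UNIV. A l $ a $ snd q * w $ q) = (\<Sum>b\<in>UNIV. A l $ a $ b * (\<Sum>j\<in>UNIV. w $ (j, b)))"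
    unfolding UNIV_Times_UNIV [symmetric] sum.cartesian_product'
    by (subst sum.swap) (simp add: sum_distrib_left)
  then show ?thesis
    by (simp add: split_coeff_def block_sum_def matrix_vector_mult_def)
qed

lemma absorption_mult:
  "(absorption e \<sigma> *v w) $ (k, a) = (if k = e then complex_of_real \<sigma> * w $ (k, a) else 0)"
proof -
  have "(absorption e \<sigma> *v w) $ (k, a) =
      (\<Sum>q\<in>UNIV. if (k, a) = q then (if k = e then complex_of_real \<sigma> * w $ q else 0) else 0)"
    unfolding matrix_vector_mult_def absorption_def vec_lambda_beta by (intro sum.cong) auto
  then show ?thesis by simp
qed

text \<open>The direct sum \<open>S \<oplus> T\<close>, of two linear subspaces, is the whole space.\<close>

definition direct_sum_UNIV :: "('v::real_vector) set \<Rightarrow> 'v set \<Rightarrow> bool" where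
  "direct_sum_UNIV S T \<longleftrightarrow> S \<inter> T = {0} \<and> {x + y | x y. x \<in> S \<and> y \<in> T} = UNIV"

definition transmission_kernel ::
    "('d::finite \<Rightarrow> complex^'m^'m) \<Rightarrow> 'd \<Rightarrow> ((complex^'m) \<times> (complex^'m)) set" where
  "transmission_kernel C e = {(w\<^sub>m, w\<^sub>p). C e *v w\<^sub>m = C e *v w\<^sub>p}"

text \<open>
  Hersh's condition for the transmission problem with zero order term \<open>B\<^sub>m\<close> in \<open>x\<^sub>1 < 0\<close> and \<open>B\<^sub>p\<close> in
  \<open>x\<^sub>1 > 0\<close>, and with the jump of \<open>C e W\<close> prescribed at \<open>x\<^sub>1 = 0\<close>.
\<close>

definition Hersh_condition ::
    "('d::finite \<Rightarrow> complex^'m^'m) \<Rightarrow> 'd \<Rightarrow> complex^'m^'m \<Rightarrow> complex^'m^'m \<Rightarrow> bool" where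
  "Hersh_condition C e B\<^sub>m B\<^sub>p \<longleftrightarrow>
     (\<exists>\<tau>\<^sub>0::real. \<forall>\<tau>. \<forall>\<eta>\<in>tangential e. Re \<tau> > \<tau>\<^sub>0 \<longrightarrow>
        direct_sum_UNIV (transmission_kernel C e)
          (decaying_values at_bot C B\<^sub>m e \<tau> \<eta> \<times> decaying_values at_top C B\<^sub>p e \<tau> \<eta>))"

text \<open>
  Zero is not a defective eigenvalue of \<open>M\<close>: the kernels of \<open>M\<close> and \<open>M\<^sup>2\<close> agree (this holds in particular
  if \<open>M\<close> is diagonalizable or invertible).
\<close>

definition semisimple_at_zero :: "complex^'n^'n \<Rightarrow> bool" where
  "semisimple_at_zero M \<longleftrightarrow> (\<forall>v. M *v (M *v v) = 0 \<longrightarrow> M *v v = 0)"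

text \<open>
  Real eigenvalues of \<open>\<Sum>l. \<xi>\<^sub>l A\<^sub>l\<close> and nondegeneracy do not force the normal matrix \<open>A e\<close> to be semisimple
  at zero, and without this Hersh's condition can fail, in any dimension and for all absorptions:
  take for \<open>A e\<close> a nilpotent Jordan block and for the other coefficients zero.
\<close>

definition jordan_coeff :: "'d::finite \<Rightarrow> 'd \<Rightarrow> complex^2^2" where
  "jordan_coeff e l = (if l = e then (\<chi> i j. if i = 1 \<and> j = 2 then 1 else 0) else 0)"

lemma mat_mult_vec: "mat (c::complex) *v v = c *s v"
  by (simp add: vec_eq_iff matrix_vector_mult_def mat_def if_distrib [of "\<lambda>x. x * _"] cong: if_cong)

lemma symbol_mult:
  fixes C :: "'d::finite \<Rightarrow> complex^'m^'m"
  shows "symbol C B \<tau> \<zeta> *v v = \<tau> *s v + (\<Sum>l\<in>UNIV. \<zeta> $ l *s (C l *v v)) + B *v v"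
proof -
  have "(\<Sum>l\<in>S. mat (\<zeta> $ l) ** C l) *v v = (\<Sum>l\<in>S. \<zeta> $ l *s (C l *v v))" if "finite S" for S
    using that
    by (induction S)
       (simp_all add: matrix_vector_mult_add_rdistrib matrix_vector_mul_assoc [symmetric] mat_mult_vec)
  then show ?thesis
    by (simp add: symbol_def matrix_vector_mult_add_rdistrib mat_mult_vec)
qed

lemma det_zero_kernel:
  fixes M :: "complex^'m^'m"
  assumes "det M = 0"
  obtains v where "v \<noteq> 0" "M *v v = 0"
  using assms invertible_det_nz [of M] invertible_left_inverse [of M] matrix_left_invertible_ker [of M]
  by auto

lemma jordan_split_symbol:
  "(symbol (split_coeff (jordan_coeff e)) (absorption e \<sigma>) \<tau> \<zeta> *v v) $ (k, a) =
     \<tau> * v $ (k, a) +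
     (if k = e then (if a = 1 then \<zeta> $ e * block_sum v $ 2 else 0) + of_real \<sigma> * v $ (k, a) else 0)"
proof -
  have "(\<Sum>l\<in>UNIV. \<zeta> $ l *s (split_coeff (jordan_coeff e) l *v v)) $ (k, a) =
      (\<Sum>l\<in>UNIV. if k = l then \<zeta> $ l * (jordan_coeff e l *v block_sum v) $ a else 0)"
    by (simp add: split_coeff_mult if_distrib [of "\<lambda>x. _ * x"] cong: if_cong)
  also have "\<dots> = (if k = e \<and> a = 1 then \<zeta> $ e * block_sum v $ 2 else 0)"
    by (auto simp: jordan_coeff_def matrix_vector_mult_def UNIV_2)
  finally show ?thesis
    by (simp add: symbol_mult absorption_mult)
qed

lemma jordan_weakly_hyperbolic: "weakly_hyperbolic (jordan_coeff e) 0"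
  unfolding weakly_hyperbolic_def
proof (rule exI [of _ 0], intro allI impI)
  fix \<tau> and \<xi> :: "real^'a"
  assume "det (symbol (jordan_coeff e) 0 \<tau> (\<chi> l. \<i> * complex_of_real (\<xi> $ l))) = 0"
  then obtain v where v: "v \<noteq> 0"
    "symbol (jordan_coeff e) 0 \<tau> (\<chi> l. \<i> * complex_of_real (\<xi> $ l)) *v v = 0"
    by (rule det_zero_kernel)
  have s: "(\<Sum>l\<in>UNIV. (\<chi> l. \<i> * complex_of_real (\<xi> $ l)) $ l *s (jordan_coeff e l *v v)) $ a =
      (\<Sum>l\<in>UNIV. if l = e then (if a = 1 then \<i> * of_real (\<xi> $ e) * v $ 2 else 0) else 0)" for a
    unfolding sum_component
    by (intro sum.cong) (auto simp: jordan_coeff_def matrix_vector_mult_def UNIV_2)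
  have *: "\<tau> * v $ a + (if a = 1 then \<i> * of_real (\<xi> $ e) * v $ 2 else 0) = 0" for a
    using arg_cong [OF v(2), of "\<lambda>w. w $ a"] s [of a] by (simp add: symbol_mult)
  show "\<bar>Re \<tau>\<bar> \<le> 0"
  proof (cases "\<tau> = 0")
    case False
    with * [of 2] have "v $ 2 = 0" by simp
    with * [of 1] False have "v $ 1 = 0" by simp
    with \<open>v $ 2 = 0\<close> v(1) show ?thesis by (simp add: vec_eq_iff forall_2)
  qed simp
qed

lemma jordan_split_weakly_hyperbolic:
  "weakly_hyperbolic (split_coeff (jordan_coeff e)) (absorption e \<sigma>)"
  unfolding weakly_hyperbolic_def
proof (rule exI [of _ "\<bar>\<sigma>\<bar>"], intro allI impI)
  fix \<tau> and \<xi> :: "real^'a"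
  let ?\<zeta> = "\<chi> l. \<i> * complex_of_real (\<xi> $ l)"
  assume "det (symbol (split_coeff (jordan_coeff e)) (absorption e \<sigma>) \<tau> ?\<zeta>) = 0"
  then obtain v where v: "v \<noteq> 0"
    "symbol (split_coeff (jordan_coeff e)) (absorption e \<sigma>) \<tau> ?\<zeta> *v v = 0"
    by (rule det_zero_kernel)
  have *: "\<tau> * v $ (k, a) + (if k = e then (if a = 1 then ?\<zeta> $ e * block_sum v $ 2 else 0)
      + of_real \<sigma> * v $ (k, a) else 0) = 0" for k a
    using arg_cong [OF v(2), of "\<lambda>w. w $ (k, a)"] by (simp only: jordan_split_symbol zero_index)
  show "\<bar>Re \<tau>\<bar> \<le> \<bar>\<sigma>\<bar>"
  proof (rule ccontr)
    assume "\<not> ?thesis"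
    then have nz: "\<tau> \<noteq> 0" "\<tau> + of_real \<sigma> \<noteq> 0"
      by (auto simp: complex_eq_iff)
    have "v $ (k, 2) = 0" for k
      using * [of k 2] nz by (cases "k = e") (auto simp: distrib_right [symmetric])
    moreover from this have "block_sum v $ 2 = 0"
      by (simp add: block_sum_def)
    then have "v $ (k, 1) = 0" for k
      using * [of k 1] nz by (cases "k = e") (auto simp: distrib_right [symmetric])
    ultimately have "v $ (k, a) = 0" for k a
      using exhaust_2 [of a] by auto
    with v(1) show False by (auto simp: vec_eq_iff)
  qed
qed

lemma jordan_nondegenerate: "nondegenerate (jordan_coeff e) 0 e"
proof -
  have "normal_poly (jordan_coeff e) 0 e \<tau> \<eta> = [:\<tau>:] * [:\<tau>:]" for \<tau> \<eta>
  proof -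
    let ?z = "\<chi> l. if l = e then [:0, 1:] else [:\<i> * complex_of_real (\<eta> $ l):]"
    have "(mat (?z $ l) ** map_matrix (\<lambda>c. [:c:]) (jordan_coeff e l)) $ i $ j =
        (if l = e then (if i = 1 \<and> j = 2 then [:0, 1:] else 0) else 0)" for l i j
      using exhaust_2 [of i] by (auto simp: matrix_matrix_mult_def mat_def UNIV_2 jordan_coeff_def)
    then show ?thesis
      by (simp add: normal_poly_def det_2 symbol_def mat_def)
  qed
  then have "degree (normal_poly (jordan_coeff e) 0 e \<tau> \<eta>) = 0" for \<tau> \<eta>
    by simp
  then show ?thesis
    unfolding nondegenerate_def by (intro exI [of _ 1]) auto
qed

lemma jordan_decaying_values:
  assumes "\<tau> \<noteq> 0" "\<tau> + of_real \<sigma> \<noteq> 0" "\<eta> \<in> tangential e"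
    and "w \<in> decaying_values F (split_coeff (jordan_coeff e)) (absorption e \<sigma>) e \<tau> \<eta>"
  shows "w $ (k, 2) = 0"
proof -
  from assms(4) obtain Z Z' :: "real \<Rightarrow> complex^('a \<times> 2)" where Z: "w = Z 0"
    "split_coeff (jordan_coeff e) e *v Z' 0 + symbol (split_coeff (jordan_coeff e)) (absorption e \<sigma>) \<tau>
       (\<chi> l. \<i> * complex_of_real (\<eta> $ l)) *v Z 0 = 0"
    by (auto simp: decaying_values_def)
  have "(split_coeff (jordan_coeff e) e *v Z' 0) $ (k, 2) = 0"
    by (simp only: split_coeff_mult) (simp add: jordan_coeff_def matrix_vector_mult_def)
  then show ?thesis
    using arg_cong [OF Z(2), of "\<lambda>u. u $ (k, 2)"] assms(1,2) Z(1)
    by (cases "k = e") (auto simp: jordan_split_symbol distrib_right [symmetric])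
qed

lemma jordan_not_Hersh:
  "\<not> Hersh_condition (split_coeff (jordan_coeff e)) e (absorption e \<sigma>\<^sub>m) (absorption e \<sigma>\<^sub>p)"
proof
  let ?C = "split_coeff (jordan_coeff e)"
  assume "Hersh_condition ?C e (absorption e \<sigma>\<^sub>m) (absorption e \<sigma>\<^sub>p)"
  then obtain \<tau>\<^sub>0 :: real where H: "direct_sum_UNIV (transmission_kernel ?C e)
      (decaying_values at_bot ?C (absorption e \<sigma>\<^sub>m) e \<tau> \<eta> \<times> decaying_values at_top ?C (absorption e \<sigma>\<^sub>p) e \<tau> \<eta>)"
    if "\<eta> \<in> tangential e" "Re \<tau> > \<tau>\<^sub>0" for \<tau> \<eta>
    unfolding Hersh_condition_def by blast
  define \<tau> where "\<tau> = complex_of_real (\<bar>\<tau>\<^sub>0\<bar> + \<bar>\<sigma>\<^sub>m\<bar> + \<bar>\<sigma>\<^sub>p\<bar> + 1)"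
  have \<tau>: "Re \<tau> > \<tau>\<^sub>0" "\<tau> \<noteq> 0" "\<tau> + of_real \<sigma>\<^sub>m \<noteq> 0" "\<tau> + of_real \<sigma>\<^sub>p \<noteq> 0"
    by (auto simp: \<tau>_def complex_eq_iff)
  have t: "0 \<in> tangential e" by (simp add: tangential_def)
  define z :: "complex^('a \<times> 2)" where "z = (\<chi> p. if p = (e, 2) then 1 else 0)"
  have "(z, 0) \<in> {x + y | x y. x \<in> transmission_kernel ?C e \<and>
      y \<in> decaying_values at_bot ?C (absorption e \<sigma>\<^sub>m) e \<tau> 0 \<times> decaying_values at_top ?C (absorption e \<sigma>\<^sub>p) e \<tau> 0}"
    using H [OF t \<tau>(1)] by (simp add: direct_sum_UNIV_def)
  then obtain a b c d where
    z: "z = a + c" "0 = b + d" and ab: "?C e *v a = ?C e *v b"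
    and c: "c \<in> decaying_values at_bot ?C (absorption e \<sigma>\<^sub>m) e \<tau> 0"
    and d: "d \<in> decaying_values at_top ?C (absorption e \<sigma>\<^sub>p) e \<tau> 0"
    by (auto simp: transmission_kernel_def)
  have C: "(?C e *v w) $ (e, 1) = (\<Sum>j\<in>UNIV. w $ (j, 2))" for w
    by (simp only: split_coeff_mult) (simp add: jordan_coeff_def matrix_vector_mult_def UNIV_2 block_sum_def)
  have cd: "c $ (k, 2) = 0" "d $ (k, 2) = 0" for k
    using jordan_decaying_values [OF \<tau>(2,3) t c] jordan_decaying_values [OF \<tau>(2,4) t d] by auto
  have "(\<Sum>j\<in>UNIV. z $ (j, 2)) = (\<Sum>j\<in>UNIV. a $ (j, 2))"
    using z(1) cd by simp
  also have "\<dots> = (\<Sum>j\<in>UNIV. b $ (j, 2))"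
    using arg_cong [OF ab, of "\<lambda>w. w $ (e, 1)"] by (simp only: C)
  also have "\<dots> = (\<Sum>j\<in>UNIV. (b + d) $ (j, 2))"
    using cd by simp
  also have "\<dots> = 0"
    using z(2) by simp
  finally show False
    by (simp add: z_def)
qed

lemma semisimple_at_zero_needed:
  "\<exists>A :: 'd::finite \<Rightarrow> complex^2^2.
     weakly_hyperbolic A 0 \<and> nondegenerate A 0 e \<and>
     weakly_hyperbolic (split_coeff A) (absorption e \<sigma>\<^sub>m) \<and>
     weakly_hyperbolic (split_coeff A) (absorption e \<sigma>\<^sub>p) \<and>
     \<not> Hersh_condition (split_coeff A) e (absorption e \<sigma>\<^sub>m) (absorption e \<sigma>\<^sub>p)"
  using jordan_weakly_hyperbolic jordan_nondegenerate jordan_split_weakly_hyperbolic jordan_not_Hersh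
  by blast

end

theory Submission
  imports Defs "HOL-Computational_Algebra.Field_as_Ring"
begin

text \<open>
  Put \<open>M = \<tau> + (\<Sum>l. \<i> \<eta>\<^sub>l A\<^sub>l)\<close>, \<open>\<kappa> = (\<tau> + \<sigma>) / \<tau>\<close> and \<open>G = M\<^sup>-\<^sup>1 A\<^sub>1\<close>.  The sum \<open>S\<close> of the blocks of a solution of the split
  differential equation satisfies \<open>G S' = - \<kappa> S\<close>, and the blocks are recovered from \<open>S\<close> by a linear map
  that does not depend on \<open>\<sigma>\<close>.  The values of the solutions decaying at \<open>\<plusminus>\<infinity>\<close> form
  the sum of the generalized eigenspaces of \<open>G\<close> for the eigenvalues \<open>\<mu> \<noteq> 0\<close> with \<open>\<plusminus> Re (\<kappa> / \<mu>) > 0\<close>.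

  A purely imaginary \<open>\<kappa> / \<mu>\<close> would be a real frequency at which the split symbol is singular.  Rescaling
  \<open>(\<tau>, \<xi>)\<close> turns \<open>\<sigma>\<close> into \<open>s \<sigma>\<close>, so this is excluded along the whole segment \<open>0 \<le> s \<le> 1\<close>, and
  \<open>Re (\<kappa> / \<mu>)\<close> has the sign of \<open>Re (1 / \<mu>)\<close> for both absorptions.  The two spaces of Hersh's condition are
  thus complementary in the sum of the generalized eigenspaces for nonzero eigenvalues, and \<open>G\<close> maps that
  sum onto its range as soon as zero is a semisimple eigenvalue of \<open>G\<close>.  At \<open>\<eta> = 0\<close> this is the
  hypothesis on \<open>A\<^sub>1\<close>.  It carries over to all \<open>(\<tau>, \<eta>)\<close> because it amounts to \<open>det (\<rho> A\<^sub>1 + M)\<close>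
  having degree \<open>rank A\<^sub>1\<close> in \<open>\<rho>\<close>, and that degree is constant by nondegeneracy.
\<close>

no_notation fps_nth (infixl "$" 75)

subsection \<open>Polynomials in a matrix\<close>

definition poly_mat :: "complex^'n^'n \<Rightarrow> complex poly \<Rightarrow> complex^'n^'n" where
  "poly_mat G p = fold_coeffs (\<lambda>a X. mat a + G ** X) p 0"

lemma mat_0 [simp]: "mat 0 = (0 :: 'a::zero^'n^'n)"
  by (simp add: mat_def vec_eq_iff)

lemma matrix_mul_zero [simp]: "A ** (0 :: 'a::semiring_1^'n^'n) = 0"
  by (simp add: matrix_matrix_mult_def vec_eq_iff)

lemma poly_mat_0 [simp]: "poly_mat G 0 = 0"
  by (simp add: poly_mat_def)

lemma poly_mat_pCons [simp]: "poly_mat G (pCons a p) = mat a + G ** poly_mat G p"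
  by (cases "p = 0 \<and> a = 0") (auto simp: poly_mat_def)

lemma poly_mat_add: "poly_mat G (p + q) *v v = poly_mat G p *v v + poly_mat G q *v v"
  by (induction p q rule: poly_induct2)
     (simp_all add: matrix_vector_mult_add_rdistrib mat_mult_vec algebra_simps
       matrix_vector_right_distrib vector_sadd_rdistrib flip: matrix_vector_mul_assoc)

lemma poly_mat_smult: "poly_mat G (smult c p) *v v = c *s (poly_mat G p *v v)"
  by (induction p)
     (simp_all add: matrix_vector_mult_add_rdistrib mat_mult_vec vector_add_ldistrib
        vector_scalar_commute flip: matrix_vector_mul_assoc)

lemma poly_mat_mult: "poly_mat G (p * q) *v v = poly_mat G p *v (poly_mat G q *v v)"
  by (induction p)
     (simp_all add: matrix_vector_mult_add_rdistrib mat_mult_vec poly_mat_add poly_mat_smult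
        flip: matrix_vector_mul_assoc)

lemma poly_mat_commute: "poly_mat G p *v (poly_mat G q *v v) = poly_mat G q *v (poly_mat G p *v v)"
  by (metis mult.commute poly_mat_mult)

lemma poly_mat_linear [simp]: "poly_mat G [:a, b:] *v v = a *s v + b *s (G *v v)"
  by (simp add: matrix_vector_mult_add_rdistrib mat_mult_vec vector_scalar_commute flip: matrix_vector_mul_assoc)

lemma poly_mat_1 [simp]: "poly_mat G 1 *v v = v"
  by (simp add: one_pCons)

lemma poly_mat_mult_commute: "poly_mat G p *v (G *v v) = G *v (poly_mat G p *v v)"
  using poly_mat_commute[of G p "[:0, 1:]" v] by simp

lemma poly_mat_monom: "poly_mat G (monom c i) *v v = c *s (((*v) G ^^ i) v)"
  by (induction i) (simp_all add: monom_0 monom_Suc mat_mult_vec vector_scalar_commute flip: matrix_vector_mul_assoc)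

lemma poly_mat_sum: "poly_mat G (sum f I) *v v = (\<Sum>i\<in>I. poly_mat G (f i) *v v)"
  by (induction I rule: infinite_finite_induct) (simp_all add: poly_mat_add)

text \<open>A Bezout identity, evaluated at \<open>G\<close>, writes \<open>v\<close> as a
  combination of vectors obtained from \<open>p(G) v\<close> and \<open>q(G) v\<close>.\<close>

lemma coprime_poly_mat_kernel:
  assumes "coprime p q" "poly_mat G p *v v = 0" "poly_mat G q *v v = 0"
  shows "v = 0"
proof -
  obtain a b where "a * p + b * q = 1"
    using assms(1) bezout_coefficients_fst_snd[of p q] by (auto simp: coprime_iff_gcd_eq_1)
  then have "v = poly_mat G (a * p + b * q) *v v" by simp
  also have "\<dots> = 0" by (simp only: poly_mat_add poly_mat_mult assms) simp
  finally show ?thesis .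
qed

text \<open>A nonconstant common divisor would have a complex root, shared by \<open>p\<close> and
  \<open>q\<close>.\<close>

lemma coprime_complex_poly:
  fixes p q :: "complex poly"
  assumes "p \<noteq> 0" "\<And>z. poly p z = 0 \<Longrightarrow> poly q z \<noteq> 0"
  shows "coprime p q"
proof (rule ccontr)
  assume *: "\<not> coprime p q"
  then have "\<not> is_unit (gcd p q)" by (simp add: coprime_iff_gcd_eq_1)
  moreover have "gcd p q \<noteq> 0" using assms(1) by simp
  ultimately have "degree (gcd p q) \<noteq> 0" using is_unit_iff_degree by blast
  then have "\<not> constant (poly (gcd p q))" by (simp add: constant_degree)
  then obtain z where "poly (gcd p q) z = 0" using fundamental_theorem_of_algebra by blast
  then show False using assms(2)[of z] by (meson dvd_trans gcd_dvd1 gcd_dvd2 poly_eq_0_iff_dvd)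
qed

text \<open>The vectors \<open>v, G v, G (G v), ...\<close> up to the power \<open>CARD('n)\<close>
  are one more than the dimension, hence linearly dependent; the coefficients of a relation are
  those of \<open>p\<close>.\<close>

lemma annihilating_poly:
  fixes G :: "complex^'n^'n"
  obtains p where "p \<noteq> 0" "poly_mat G p *v v = 0"
proof -
  define f where "f i = ((*v) G ^^ i) v" for i :: nat
  show thesis
  \<comment> \<open>Dependence is a property of sets of vectors, so a repetition in the list is
    treated apart; it yields a difference of two monomials.\<close>
  proof (cases "inj_on f {..CARD('n)}")
    case False
    then obtain i j where "i \<noteq> j" "f i = f j" by (auto simp: inj_on_def)
    then have "monom 1 i + smult (-1) (monom 1 j) \<noteq> (0::complex poly)"
      by (simp add: poly_eq_iff) (metis diff_zero zero_neq_one)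
    moreover have "poly_mat G (monom 1 i + smult (-1) (monom 1 j)) *v v = 0"
      using \<open>f i = f j\<close> by (simp only: poly_mat_add poly_mat_smult poly_mat_monom f_def) simp
    ultimately show thesis using that by blast
  next
    case True
    then have "card (f ` {..CARD('n)}) = Suc CARD('n)" by (simp add: card_image)
    then have "vec.dependent (f ` {..CARD('n)})"
      using vec.dependent_biggerset_general[of "f ` {..CARD('n)}"] vec.dim_subset[of "f ` {..CARD('n)}" UNIV]
      by (simp only: vec_dim_card) simp
    then obtain u w where u: "w \<in> f ` {..CARD('n)}" "u w \<noteq> 0" "(\<Sum>x\<in>f ` {..CARD('n)}. u x *s x) = 0"
      by (subst (asm) vec.dependent_finite) auto
    define p where "p = (\<Sum>i\<le>CARD('n). monom (u (f i)) i)"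
    have "poly_mat G p *v v = (\<Sum>i\<le>CARD('n). u (f i) *s f i)"
      by (simp add: p_def poly_mat_sum poly_mat_monom f_def)
    also have "\<dots> = 0" using u(3) True by (simp add: sum.reindex)
    finally have "poly_mat G p *v v = 0" .
    moreover obtain i where "i \<le> CARD('n)" "w = f i" using u(1) by auto
    then have "coeff p i \<noteq> 0" using u(2) by (simp add: p_def coeff_sum)
    then have "p \<noteq> 0" by auto
    ultimately show thesis using that by blast
  qed
qed

text \<open>The product of annihilators of the basis vectors kills each of them, because polynomials
  in \<open>G\<close> commute.\<close>

lemma annihilating_poly_all:
  fixes G :: "complex^'n^'n"
  obtains p where "p \<noteq> 0" "\<And>v. poly_mat G p *v v = 0"
proof -
  have "\<forall>i::'n. \<exists>p. p \<noteq> 0 \<and> poly_mat G p *v axis i 1 = 0"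
    by (meson annihilating_poly)
  then obtain f where f: "\<And>i::'n. f i \<noteq> 0" "\<And>i. poly_mat G (f i) *v axis i 1 = 0"
    unfolding choice_iff by blast
  have *: "poly_mat G (\<Prod>i\<in>UNIV. f i) *v axis i 1 = 0" for i
    by (subst prod.remove[of _ i]) (simp_all only: mult.commute[of "f i"] poly_mat_mult f, simp_all)
  have "poly_mat G (\<Prod>i\<in>UNIV. f i) = 0"
    using * by (simp add: vec_eq_iff matrix_vector_mul_component inner_axis matrix_vector_mult_def axis_def if_distrib cong: if_cong)
  then show thesis using that[of "\<Prod>i\<in>UNIV. f i"] f(1) by simp
qed

text \<open>The primary decomposition as an induction rule: every \<open>u\<close> is a sum of
  generalized eigenvectors of \<open>G\<close>. Exponent 0 in \<open>gen\<close> covers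
  \<open>u = 0\<close>.\<close>

lemma generalized_eigenvector_induct:
  fixes G :: "complex^'n^'n" and u :: "complex^'n"
  assumes add: "\<And>s t. P s \<Longrightarrow> P t \<Longrightarrow> P (s + t)"
    and gen: "\<And>z k s. poly_mat G ([:-z, 1:] ^ k) *v s = 0 \<Longrightarrow> P s"
  shows "P u"
proof -
  have "poly_mat G p *v u = 0 \<Longrightarrow> P u" if "p \<noteq> 0" for p u
    using that
  proof (induction "degree p" arbitrary: p u rule: less_induct)
    case less
    show ?case
    proof (cases "degree p = 0")
      case True
      then obtain c where "p = [:c:]" by (meson degree_eq_zeroE)
      with less.prems have "u = 0" by (simp add: mat_mult_vec vec.scale_eq_0_iff)
      then show ?thesis using gen[of 0 0 u] by simp
    next
      case False
      then obtain z where z: "poly p z = 0"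
        using fundamental_theorem_of_algebra[of p] by (auto simp: constant_degree)
      define k where "k = order z p"
      obtain q where q: "p = [:-z, 1:] ^ k * q" "\<not> [:-z, 1:] dvd q"
        using order_decomp[OF \<open>p \<noteq> 0\<close>] unfolding k_def by blast
      have "k \<noteq> 0" using z \<open>p \<noteq> 0\<close> by (simp add: k_def order_root)
      have "q \<noteq> 0" using q(2) by auto
      then have deg: "degree q < degree p"
        using \<open>k \<noteq> 0\<close> by (simp add: q(1) degree_mult_eq degree_linear_power)
      have "coprime ([:-z, 1:] ^ k) q"
        using q(2) by (intro coprime_complex_poly) (auto simp: poly_eq_0_iff_dvd)
      then obtain a b where ab: "a * [:-z, 1:] ^ k + b * q = 1"
        using bezout_coefficients_fst_snd[of "[:-z, 1:] ^ k" q] by (auto simp: coprime_iff_gcd_eq_1)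
      \<comment> \<open>The Bezout identity splits \<open>u\<close> into \<open>t\<close>, killed by
        the power of \<open>[:-z, 1:]\<close>, and \<open>s\<close>, killed by the cofactor
        \<open>q\<close> of smaller degree.\<close>
      define s where "s = poly_mat G (a * [:-z, 1:] ^ k) *v u"
      define t where "t = poly_mat G (b * q) *v u"
      have "u = poly_mat G (a * [:-z, 1:] ^ k + b * q) *v u" by (simp add: ab)
      then have u: "u = s + t" by (simp only: poly_mat_add s_def t_def)
      have "poly_mat G q *v s = poly_mat G (a * p) *v u"
        unfolding s_def q(1) by (simp only: poly_mat_mult[symmetric] mult_ac)
      then have "P s" using less.hyps[OF deg _ \<open>q \<noteq> 0\<close>] less.prems(1) by (simp add: poly_mat_mult)
      have "poly_mat G ([:-z, 1:] ^ k) *v t = poly_mat G (b * p) *v u"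
        unfolding t_def q(1) by (simp only: poly_mat_mult[symmetric] mult_ac)
      then have "P t" using gen less.prems(1) by (simp add: poly_mat_mult)
      with \<open>P s\<close> show ?thesis unfolding u by (rule add)
    qed
  qed
  with annihilating_poly[of G u] show ?thesis by metis
qed

subsection \<open>Decaying solutions of \<open>G Z' = - \<kappa> Z\<close>\<close>

text \<open>The equation stays in implicit form because \<open>G\<close> may be singular. Only
  \<open>at_top\<close> occurs: reflection in \<open>x\<close> turns \<open>at_bot\<close> into this
  case with \<open>- \<kappa>\<close>.\<close>

definition decaying_solution :: "complex^'n^'n \<Rightarrow> complex \<Rightarrow> (real \<Rightarrow> complex^'n) \<Rightarrow> bool" where
  "decaying_solution G \<kappa> Z \<longleftrightarrow>
     (\<exists>Z'. (\<forall>x. (Z has_vector_derivative Z' x) (at x)) \<and> (\<forall>x. G *v Z' x = - \<kappa> *s Z x)) \<and>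
     (Z \<longlongrightarrow> 0) at_top"

definition decaying_data :: "complex^'n^'n \<Rightarrow> complex \<Rightarrow> (complex^'n) set" where
  "decaying_data G \<kappa> = {Z 0 | Z. decaying_solution G \<kappa> Z}"

lemma decaying_data_0: "0 \<in> decaying_data G \<kappa>"
proof -
  have "decaying_solution G \<kappa> (\<lambda>x. 0)"
    unfolding decaying_solution_def by (intro conjI exI[of _ "\<lambda>x. 0"]) auto
  then show ?thesis unfolding decaying_data_def by (auto intro!: exI[of _ "\<lambda>x. 0"])
qed

lemma decaying_solution_add:
  assumes "decaying_solution G \<kappa> Y" "decaying_solution G \<kappa> Z"
  shows "decaying_solution G \<kappa> (\<lambda>x. Y x + Z x)"
proof -
  obtain Y' Z' where *: "\<And>x. (Y has_vector_derivative Y' x) (at x)" "\<And>x. G *v Y' x = - \<kappa> *s Y x"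
      "(Y \<longlongrightarrow> 0) at_top" "\<And>x. (Z has_vector_derivative Z' x) (at x)" "\<And>x. G *v Z' x = - \<kappa> *s Z x"
      "(Z \<longlongrightarrow> 0) at_top"
    using assms unfolding decaying_solution_def by blast
  then show ?thesis
    unfolding decaying_solution_def
    by (intro conjI exI[of _ "\<lambda>x. Y' x + Z' x"] allI has_vector_derivative_add tendsto_add_zero)
       (auto simp: matrix_vector_right_distrib vector_add_ldistrib)
qed

lemma decaying_solution_poly_mat:
  assumes "decaying_solution G \<kappa> Z"
  shows "decaying_solution G \<kappa> (\<lambda>x. poly_mat G p *v Z x)"
proof -
  obtain Z' where *: "\<And>x. (Z has_vector_derivative Z' x) (at x)" "\<And>x. G *v Z' x = - \<kappa> *s Z x"
      "(Z \<longlongrightarrow> 0) at_top"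
    using assms unfolding decaying_solution_def by blast
  have "G *v (poly_mat G p *v Z' x) = - \<kappa> *s (poly_mat G p *v Z x)" for x
    by (simp only: poly_mat_mult_commute[symmetric] *(2) vector_scalar_commute)
  moreover have "((\<lambda>x. poly_mat G p *v Z x) \<longlongrightarrow> poly_mat G p *v 0) at_top"
    by (intro bounded_linear.tendsto[OF matrix_vector_mul_bounded_linear] *)
  ultimately show ?thesis
    unfolding decaying_solution_def
    by (intro conjI exI[of _ "\<lambda>x. poly_mat G p *v Z' x"] allI
        bounded_linear.has_vector_derivative[OF matrix_vector_mul_bounded_linear] *) auto
qed

text \<open>An integrating factor gives \<open>f x = a * exp (- x c)\<close>, whose modulus is at
  least \<open>norm a\<close> for \<open>x \<ge> 0\<close>.\<close>

lemma decaying_scalar_zero: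
  fixes f :: "real \<Rightarrow> complex"
  assumes "\<And>x. (f has_vector_derivative - c * f x) (at x)" "(f \<longlongrightarrow> 0) at_top" "Re c \<le> 0"
  shows "f x = 0"
proof -
  define g where "g x = exp (of_real x * c) * f x" for x
  have "(g has_vector_derivative 0) (at x)" for x
  proof -
    have "((\<lambda>x. exp (of_real x * c)) has_vector_derivative exp (of_real x * c) * c) (at x)"
      by (rule has_vector_derivative_real_field) (auto intro!: derivative_eq_intros)
    then show ?thesis
      unfolding g_def using assms(1)[of x]
      by (auto intro!: derivative_eq_intros simp: algebra_simps)
  qed
  then obtain a where "\<And>x. g x = a"
    using has_vector_derivative_zero_constant[of UNIV g] by auto
  then have fx: "f x = a * exp (- of_real x * c)" for x
  proof -
    have "f x = exp (of_real x * c) * exp (- (of_real x * c)) * f x"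
      by (simp only: exp_minus_inverse) simp
    also have "\<dots> = g x * exp (- of_real x * c)" by (simp add: g_def mult_ac)
    finally show ?thesis by (simp only: \<open>g x = a\<close>)
  qed
  have "((\<lambda>x. norm (f x)) \<longlongrightarrow> 0) at_top"
    using assms(2) by (rule tendsto_norm_zero)
  moreover have "eventually (\<lambda>x. norm a \<le> norm (f x)) at_top"
    using eventually_ge_at_top[of 0]
    by eventually_elim
       (use assms(3) in \<open>auto simp: fx norm_mult mult_nonneg_nonpos intro!: mult_left_mono[of 1 _ "norm a", simplified]\<close>)
  ultimately have "norm a \<le> 0"
    by (intro tendsto_lowerbound[of _ _ at_top]) auto
  then show ?thesis by (simp add: fx)
qed

text \<open>Differentiating \<open>G Z = z Z\<close> gives \<open>G Z' = z Z'\<close>, so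
  \<open>z Z' = - \<kappa> Z\<close>. For \<open>z = 0\<close>, which meets the last hypothesis as
  \<open>\<kappa> / 0 = 0\<close>, this forces \<open>Z = 0\<close> at once; otherwise every
  component solves a scalar equation without nonzero decaying solutions.\<close>

lemma decaying_eigen_solution_zero:
  assumes "decaying_solution G \<kappa> Z" "\<And>x. G *v Z x = z *s Z x" "\<kappa> \<noteq> 0" "Re (\<kappa> / z) \<le> 0"
  shows "Z x = 0"
proof -
  obtain Z' where *: "\<And>x. (Z has_vector_derivative Z' x) (at x)" "\<And>x. G *v Z' x = - \<kappa> *s Z x"
      "(Z \<longlongrightarrow> 0) at_top"
    using assms(1) unfolding decaying_solution_def by blast
  have "((\<lambda>x. (G - mat z) *v Z x) has_vector_derivative (G - mat z) *v Z' x) (at x)" for x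
    by (intro bounded_linear.has_vector_derivative[OF matrix_vector_mul_bounded_linear] *)
  moreover have "(\<lambda>x. (G - mat z) *v Z x) = (\<lambda>x. 0)"
    by (simp add: matrix_vector_mult_diff_rdistrib mat_mult_vec assms(2))
  ultimately have "(G - mat z) *v Z' x = 0" for x
    using vector_derivative_unique_at has_vector_derivative_const by metis
  then have z: "z *s Z' x = - \<kappa> *s Z x" for x
    using *(2)[of x] by (simp add: matrix_vector_mult_diff_rdistrib mat_mult_vec)
  show ?thesis
  proof (cases "z = 0")
    case True
    with z[of x] \<open>\<kappa> \<noteq> 0\<close> show ?thesis by (simp add: vec.scale_eq_0_iff)
  next
    case False
    have "Z x $ i = 0" for i
    proof (rule decaying_scalar_zero)
      fix x
      have "Z' x $ i = - (\<kappa> / z) * Z x $ i"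
        using arg_cong[OF z[of x], of "\<lambda>v. v $ i"] False by (simp add: field_simps)
      from this[symmetric] show "((\<lambda>x. Z x $ i) has_vector_derivative - (\<kappa> / z) * Z x $ i) (at x)"
        using bounded_linear.has_vector_derivative[OF bounded_linear_vec_nth *(1), of i] by (simp only:)
    next
      show "((\<lambda>x. Z x $ i) \<longlongrightarrow> 0) at_top"
        using tendsto_vec_nth[OF *(3), of i] by simp
    qed (fact assms(4))
    then show ?thesis by (simp add: vec_eq_iff)
  qed
qed

text \<open>Decaying data only involve eigenvalues with \<open>Re (\<kappa> / z) > 0\<close>. An
  annihilator records this in a form suited to coprimality arguments.\<close>

lemma decaying_data_annihilator:
  assumes "s \<in> decaying_data G \<kappa>" "\<kappa> \<noteq> 0"
  obtains q where "q \<noteq> 0" "poly_mat G q *v s = 0"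
    "\<And>z. poly q z = 0 \<Longrightarrow> Re (\<kappa> / z) > 0 \<and> (\<exists>v. v \<noteq> 0 \<and> G *v v = z *s v)"
proof -
  from assms obtain Z where Z: "decaying_solution G \<kappa> Z" "s = Z 0"
    by (auto simp: decaying_data_def)
  let ?good = "\<lambda>z. Re (\<kappa> / z) > 0 \<and> (\<exists>v. v \<noteq> 0 \<and> G *v v = z *s v)"
  \<comment> \<open>Remove the bad roots of an annihilating polynomial one at a time: removing \<open>z\<close> leaves a decaying
    solution with values in the eigenspace of \<open>z\<close>, which vanishes.\<close>
  have "\<exists>q. q \<noteq> 0 \<and> (\<forall>x. poly_mat G q *v Z x = 0) \<and> (\<forall>z. poly q z = 0 \<longrightarrow> ?good z)"
    if "p \<noteq> 0" "\<forall>x. poly_mat G p *v Z x = 0" for p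
    using that
  proof (induction "degree p" arbitrary: p rule: less_induct)
    case less
    show ?case
    proof (cases "\<forall>z. poly p z = 0 \<longrightarrow> ?good z")
      case False
      then obtain z where z: "poly p z = 0" "\<not> ?good z" by blast
      then obtain q where q: "p = [:-z, 1:] * q" by (auto simp: poly_eq_0_iff_dvd)
      with less.prems have "q \<noteq> 0" by auto
      define U where "U x = poly_mat G q *v Z x" for x
      have U: "decaying_solution G \<kappa> U"
        using decaying_solution_poly_mat[OF Z(1)] by (simp add: U_def[abs_def])
      have eig: "G *v U x = z *s U x" for x
      proof -
        have "poly_mat G [:-z, 1:] *v U x = 0"
          using less.prems(2) by (simp only: U_def q poly_mat_mult)
        then show ?thesis by (simp only: poly_mat_linear) (simp add: vector_smult_lneg)
      qed
      \<comment> \<open>A bad root \<open>z\<close> is either no eigenvalue, and then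
        \<open>U x\<close> cannot be nonzero, or has \<open>Re (\<kappa> / z) \<le> 0\<close>, and
        then decay forces \<open>U\<close> to vanish.\<close>
      have "U x = 0" for x
        using z(2) eig decaying_eigen_solution_zero[OF U eig assms(2)] by fastforce
      moreover have "degree q < degree p"
        unfolding q using \<open>q \<noteq> 0\<close> by (subst degree_mult_eq) auto
      ultimately show ?thesis
        using less.hyps[of q] \<open>q \<noteq> 0\<close> by (simp add: U_def)
    qed (use less.prems in blast)
  qed
  moreover obtain p where "p \<noteq> 0" "\<And>v. poly_mat G p *v v = 0"
    by (meson annihilating_poly_all)
  ultimately show thesis using that unfolding Z(2) by blast
qed

section \<open>Exponential solutions on generalized eigenspaces\<close>

lemma exp_monomial_decay:
  fixes c \<kappa> :: complex
  assumes "Re c > 0"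
  shows "((\<lambda>x. exp (- of_real x * c) * (- \<kappa> * of_real x) ^ j / fact j) \<longlongrightarrow> 0) at_top"
proof (rule tendsto_norm_zero_cancel)
  \<comment> \<open>In the variable \<open>t = x * Re c\<close> the modulus is a constant times
    \<open>t ^ j / exp t\<close>.\<close>
  have "((\<lambda>x. norm \<kappa> ^ j / (Re c ^ j * fact j) * ((x * Re c) ^ j / exp (x * Re c))) \<longlongrightarrow>
          norm \<kappa> ^ j / (Re c ^ j * fact j) * 0) at_top"
    by (intro tendsto_mult tendsto_const filterlim_compose[OF tendsto_power_div_exp_0]
        filterlim_at_top_mult_tendsto_pos[OF tendsto_const assms] filterlim_ident)
  moreover have "norm \<kappa> ^ j / (Re c ^ j * fact j) * ((x * Re c) ^ j / exp (x * Re c)) =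
      norm (exp (- of_real x * c) * (- \<kappa> * of_real x) ^ j / fact j)" if "x \<ge> 0" for x
    using assms that
    by (simp add: norm_mult norm_divide norm_power power_mult_distrib exp_minus field_simps)
  ultimately show "((\<lambda>x. norm (exp (- of_real x * c) * (- \<kappa> * of_real x) ^ j / fact j)) \<longlongrightarrow> 0) at_top"
    by (auto elim!: Lim_transform_eventually intro!: eventually_mono[OF eventually_ge_at_top[of 0]])
qed

text \<open>For \<open>c = \<kappa> / z\<close> these are the scalar coefficients of
  \<open>exp (- \<kappa> x G\<^sup>-\<^sup>1)\<close> on a generalized eigenspace. The case
  \<open>j = 0\<close> is separate because \<open>j - 1\<close> truncates there.\<close>

lemma exp_monomial_derivative:
  fixes c \<kappa> :: complex
  defines "g \<equiv> \<lambda>j x. exp (- of_real x * c) * (- \<kappa> * of_real x) ^ j / fact j"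
  shows "(g j has_vector_derivative - c * g j x - (if j = 0 then 0 else \<kappa> * g (j - 1) x)) (at x)"
proof -
  have "((\<lambda>z. exp (- z * c) * (- \<kappa> * z) ^ j / fact j) has_field_derivative
      (- c * g j x - (if j = 0 then 0 else \<kappa> * g (j - 1) x))) (at (of_real x))"
  proof (cases j)
    case (Suc i)
    have f: "fact (Suc i) = (of_nat (Suc i) * fact i :: complex)" "(of_nat (Suc i) :: complex) \<noteq> 0"
      unfolding fact_Suc using of_nat_neq_0 by auto
    have "((\<lambda>z. (- \<kappa> * z) ^ Suc i) has_field_derivative - \<kappa> * of_nat (Suc i) * (- \<kappa> * w) ^ i) (at w)" for w
      by (rule derivative_eq_intros refl)+ simp
    moreover have "((\<lambda>z. exp (- z * c)) has_field_derivative - c * exp (- w * c)) (at w)" for w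
      by (auto intro!: derivative_eq_intros)
    ultimately show ?thesis unfolding g_def Suc
      by (rule DERIV_cong[OF DERIV_cdivide[OF DERIV_mult[rotated]]])
         (simp add: f(1) field_simps f(2) del: of_nat_Suc fact_Suc)
  qed (auto intro!: derivative_eq_intros simp: g_def)
  then show ?thesis unfolding g_def
    by (rule has_vector_derivative_real_field)
qed

lemma bounded_linear_smult_vec: "bounded_linear (\<lambda>c. c *s (v :: complex^'n))"
  unfolding linear_conv_bounded_linear[symmetric]
  by (rule linearI) (simp_all add: vector_sadd_rdistrib vec_eq_iff)

lemma decaying_data_generalized_eigenvector:
  fixes G :: "complex^'n^'n"
  assumes "poly_mat G ([:-z, 1:] ^ k) *v s = 0" "Re (\<kappa> / z) > 0"
  shows "s \<in> decaying_data G \<kappa>"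
proof (cases "k = 0")
  case False
  have "z \<noteq> 0" using assms(2) by auto
  have "coprime [:0, 1:] ([:-z, 1:] ^ k)"
    using \<open>z \<noteq> 0\<close> by (intro coprime_complex_poly) auto
  then obtain a b where ab: "a * [:0, 1:] + b * [:-z, 1:] ^ k = 1"
    using bezout_coefficients_fst_snd[of "[:0, 1:]" "[:-z, 1:] ^ k"] by (auto simp: coprime_iff_gcd_eq_1)
  \<comment> \<open>On the kernel of \<open>(G - z)\<^sup>k\<close>, \<open>a(G)\<close> inverts \<open>G\<close>, so \<open>r(G)\<close> is the nilpotent part of \<open>G\<^sup>-\<^sup>1\<close> there, and
    \<open>Z\<close> below is \<open>exp (- \<kappa> x G\<^sup>-\<^sup>1) s\<close>.\<close>
  define r where "r = a - [:1 / z:]"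
  \<comment> \<open>At \<open>z\<close> the term with \<open>b\<close> vanishes, as
    \<open>k > 0\<close>, which leaves \<open>a(z) z = 1\<close>. Hence \<open>z\<close> is a root
    of \<open>r\<close>, so \<open>r ^ k\<close> is a multiple of \<open>[:-z, 1:] ^ k\<close> and
    \<open>v k\<close> is zero.\<close>
  have "poly (a * [:0, 1:] + b * [:-z, 1:] ^ k) z = 1" by (simp only: ab) simp
  then have "poly r z = 0" using False \<open>z \<noteq> 0\<close> by (cases k) (simp_all add: r_def field_simps)
  then obtain h where h: "r = h * [:-z, 1:]" by (metis dvdE mult.commute poly_eq_0_iff_dvd)
  define v where "v j = poly_mat G (r ^ j) *v s" for j
  have kill: "poly_mat G ([:-z, 1:] ^ k) *v (poly_mat G p *v s) = 0" for p
    by (subst poly_mat_commute) (simp add: assms(1))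
  have vk: "v k = 0"
    by (simp only: v_def h power_mult_distrib poly_mat_mult assms(1)) simp
  have Gv: "G *v (v (Suc j) + (1 / z) *s v j) = v j" for j
  proof -
    have "v (Suc j) + (1 / z) *s v j = poly_mat G (a * r ^ j) *v s"
    proof -
      have "a * r ^ j = r ^ Suc j + smult (1 / z) (r ^ j)" by (simp add: r_def algebra_simps)
      then show ?thesis by (simp only: poly_mat_add poly_mat_smult v_def)
    qed
    then have "G *v (v (Suc j) + (1 / z) *s v j) = poly_mat G [:0, 1:] *v (poly_mat G (a * r ^ j) *v s)"
      by (simp only: poly_mat_linear) simp
    also have "\<dots> = poly_mat G ((a * [:0, 1:]) * r ^ j) *v s"
      by (simp only: poly_mat_mult[symmetric] mult_ac)
    \<comment> \<open>The added term is zero by \<open>kill\<close>; it completes the Bezout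
      identity.\<close>
    also have "\<dots> + poly_mat G (b * [:-z, 1:] ^ k) *v (poly_mat G (r ^ j) *v s) = poly_mat G (r ^ j) *v s"
      by (simp only: poly_mat_mult[of _ "a * [:0, 1:]"] poly_mat_add[symmetric] ab poly_mat_1)
    finally show ?thesis by (simp add: v_def poly_mat_mult kill)
  qed
  define g where "g j x = exp (- of_real x * (\<kappa> / z)) * (- \<kappa> * of_real x) ^ j / fact j" for j and x :: real
  define g' where "g' j x = - (\<kappa> / z) * g j x - (if j = 0 then 0 else \<kappa> * g (j - 1) x)" for j and x :: real
  define Z where "Z x = (\<Sum>j<k. g j x *s v j)" for x
  have "(g j has_vector_derivative g' j x) (at x)" for j x
    using exp_monomial_derivative[where j = j and c = "\<kappa> / z" and \<kappa> = \<kappa>] by (simp only: g'_def g_def[abs_def])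
  then have 1: "(Z has_vector_derivative (\<Sum>j<k. g' j x *s v j)) (at x)" for x
    unfolding Z_def
    by (intro has_vector_derivative_sum bounded_linear.has_vector_derivative[OF bounded_linear_smult_vec])
  have 2: "(\<Sum>j<k. g' j x *s v j) = (\<Sum>j<k. (- \<kappa> * g j x) *s (v (Suc j) + (1 / z) *s v j))" for x
  proof -
    \<comment> \<open>The index shift brings in a term with \<open>v k\<close>, which is zero, so no
      boundary term remains.\<close>
    have "(\<Sum>j<k. (if j = 0 then 0 else \<kappa> * g (j - 1) x) *s v j) =
        (\<Sum>j<Suc k. (if j = 0 then 0 else \<kappa> * g (j - 1) x) *s v j)"
      by (simp add: vk)
    also have "\<dots> = (\<Sum>j<k. (\<kappa> * g j x) *s v (Suc j))"
      by (subst sum.lessThan_Suc_shift) simp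
    finally show ?thesis
      by (simp add: g'_def vector_sub_rdistrib vector_add_ldistrib sum_subtractf sum.distrib sum_negf
         vector_smult_assoc vector_smult_lneg)
  qed
  have 3: "G *v (\<Sum>j<k. g' j x *s v j) = - \<kappa> *s Z x" for x
    unfolding 2 Z_def vec.scale_sum_right
    by (simp only: linear_sum[OF matrix_vector_mul_linear] vector_scalar_commute Gv vector_smult_assoc)
  have "(Z \<longlongrightarrow> (\<Sum>j<k. 0 *s v j)) at_top"
    unfolding Z_def
    by (intro tendsto_sum bounded_linear.tendsto[OF bounded_linear_smult_vec])
       (use exp_monomial_decay[OF assms(2), of \<kappa>] in \<open>simp add: g_def\<close>)
  with 1 3 have "decaying_solution G \<kappa> Z"
    unfolding decaying_solution_def
    by (intro conjI exI[of _ "\<lambda>x. \<Sum>j<k. g' j x *s v j"]) auto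
  moreover have "Z 0 = s"
  proof -
    have "Z 0 = (\<Sum>j<k. if j = 0 then s else 0)"
      unfolding Z_def by (intro sum.cong) (auto simp: g_def v_def)
    also have "\<dots> = s" using False by simp
    finally show ?thesis .
  qed
  ultimately show ?thesis unfolding decaying_data_def by blast
next
  case True
  with assms have "s = 0" by simp
  then show ?thesis by (simp add: decaying_data_0)
qed

section \<open>Complementarity of the decaying data for two coefficients\<close>

lemma decaying_data_add:
  assumes "s \<in> decaying_data G \<kappa>" "t \<in> decaying_data G \<kappa>"
  shows "s + t \<in> decaying_data G \<kappa>"
proof -
  obtain Y Z where "decaying_solution G \<kappa> Y" "decaying_solution G \<kappa> Z" and [simp]: "s = Y 0" "t = Z 0"
    using assms by (auto simp: decaying_data_def)
  from decaying_solution_add[OF this(1,2)] show ?thesis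
    by (auto simp: decaying_data_def)
qed

lemma not_eigenvalue_power_kernel:
  assumes "\<And>v. G *v v = z *s v \<Longrightarrow> v = 0" "poly_mat G ([:-z, 1:] ^ k) *v s = 0"
  shows "s = 0"
  using assms(2)
proof (induction k arbitrary: s)
  case (Suc k)
  have "poly_mat G ([:-z, 1:] ^ k) *v (poly_mat G [:-z, 1:] *v s) = 0"
    using Suc.prems by (simp only: power_Suc2 poly_mat_mult)
  from Suc.IH[OF this] have "G *v s = z *s s"
    by (simp only: poly_mat_linear) (simp add: vector_smult_lneg)
  then show ?case by (rule assms(1))
qed simp

text \<open>Induction lowers the power to \<open>G (G s) = 0\<close>, where semisimplicity applies.
  The form \<open>[:-0, 1:]\<close> matches the induction rule at \<open>z = 0\<close>.\<close>

lemma semisimple_at_zero_power_kernel: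
  assumes "semisimple_at_zero G" "poly_mat G ([:-0, 1:] ^ k) *v s = 0"
  shows "G *v s = 0"
  using assms(2)
proof (induction k arbitrary: s)
  case (Suc k)
  have "poly_mat G ([:-0, 1:] ^ k) *v (poly_mat G [:-0, 1:] *v s) = 0"
    using Suc.prems by (simp only: power_Suc2 poly_mat_mult)
  then have "poly_mat G ([:-0, 1:] ^ k) *v (G *v s) = 0"
    by (simp only: poly_mat_linear) simp
  from Suc.IH[OF this] show ?case
    using assms(1) by (simp add: semisimple_at_zero_def)
qed simp

text \<open>The spanning half of the direct sum, modulo the kernel of \<open>G\<close>. By
  additivity \<open>u\<close> may be a generalized eigenvector: at \<open>z = 0\<close> it lies in
  the kernel of \<open>G\<close>, for \<open>z\<close> not an eigenvalue it vanishes, and otherwise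
  \<open>split\<close> names a space that contains it.\<close>

lemma decaying_data_complement:
  fixes G :: "complex^'n^'n"
  assumes "semisimple_at_zero G"
    and split: "\<And>z v. v \<noteq> 0 \<Longrightarrow> G *v v = z *s v \<Longrightarrow> z \<noteq> 0 \<Longrightarrow> Re (\<kappa> / z) > 0 \<or> Re (\<mu> / z) > 0"
  shows "\<exists>s\<in>decaying_data G \<kappa>. \<exists>t\<in>decaying_data G \<mu>. G *v u = G *v (s - t)"
proof (induction u rule: generalized_eigenvector_induct[where G = G])
  case (1 u v)
  then obtain s t s' t' where "s \<in> decaying_data G \<kappa>" "t \<in> decaying_data G \<mu>" "G *v u = G *v (s - t)"
    "s' \<in> decaying_data G \<kappa>" "t' \<in> decaying_data G \<mu>" "G *v v = G *v (s' - t')" by blast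
  then show ?case
    by (intro bexI[of _ "s + s'"] bexI[of _ "t + t'"])
       (auto intro: decaying_data_add simp: matrix_vector_right_distrib matrix_vector_mult_diff_distrib)
next
  case (2 z k u)
  consider "z = 0" | "\<And>v. G *v v = z *s v \<Longrightarrow> v = 0" | "Re (\<kappa> / z) > 0" | "Re (\<mu> / z) > 0"
    using split by blast
  then show ?case
  proof cases
    case 1
    then have "G *v u = 0" using semisimple_at_zero_power_kernel[OF assms(1)] 2 by simp
    then show ?thesis
      by (intro bexI[of _ 0] decaying_data_0) simp
  next
    case b: 2
    then have "u = 0" using not_eigenvalue_power_kernel 2 by blast
    then show ?thesis
      by (intro bexI[of _ 0] decaying_data_0) simp
  next
    case 3
    then have "u \<in> decaying_data G \<kappa>" using decaying_data_generalized_eigenvector 2 by blast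
    then show ?thesis
      by (intro bexI[of _ u] bexI[of _ 0] decaying_data_0) simp_all
  next
    case 4
    \<comment> \<open>The sign comes from the difference \<open>s - t\<close>, here with
      \<open>s = 0\<close>.\<close>
    have "poly_mat G ([:-z, 1:] ^ k) *v (- u) = 0" using 2 by (simp add: vec.neg)
    then have "- u \<in> decaying_data G \<mu>" using decaying_data_generalized_eigenvector 4 by blast
    then show ?thesis
      by (intro bexI[of _ "0 :: complex^'n"] bexI[of _ "- u"] decaying_data_0) simp_all
  qed
qed

text \<open>The annihilators of \<open>s\<close> and \<open>t\<close> have no common root, by
  \<open>split\<close>, yet both kill \<open>G s = G t\<close>. So this vector is zero, and
  \<open>s\<close> and \<open>t\<close> lie in the kernel of \<open>G\<close>, which holds no
  nonzero decaying data.\<close>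

lemma decaying_data_independent:
  assumes "s \<in> decaying_data G \<kappa>" "t \<in> decaying_data G \<mu>" "G *v s = G *v t" "\<kappa> \<noteq> 0" "\<mu> \<noteq> 0"
    and split: "\<And>z v. v \<noteq> 0 \<Longrightarrow> G *v v = z *s v \<Longrightarrow> \<not> (Re (\<kappa> / z) > 0 \<and> Re (\<mu> / z) > 0)"
  shows "s = 0 \<and> t = 0"
proof -
  obtain p where p: "p \<noteq> 0" "poly_mat G p *v s = 0"
    "\<And>z. poly p z = 0 \<Longrightarrow> Re (\<kappa> / z) > 0 \<and> (\<exists>v. v \<noteq> 0 \<and> G *v v = z *s v)"
    using decaying_data_annihilator[OF assms(1,4)] by blast
  obtain q where q: "q \<noteq> 0" "poly_mat G q *v t = 0"
    "\<And>z. poly q z = 0 \<Longrightarrow> Re (\<mu> / z) > 0 \<and> (\<exists>v. v \<noteq> 0 \<and> G *v v = z *s v)"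
    using decaying_data_annihilator[OF assms(2,5)] by blast
  have "coprime p q"
    by (rule coprime_complex_poly) (use p(1,3) q(3) split in meson)+
  moreover have "poly_mat G p *v (G *v s) = 0"
    by (simp add: poly_mat_mult_commute p(2))
  moreover have "poly_mat G q *v (G *v s) = 0"
    by (simp add: assms(3) poly_mat_mult_commute q(2))
  ultimately have G: "G *v s = 0" "G *v t = 0"
    using coprime_poly_mat_kernel assms(3) by auto
  have 0: "poly_mat G [:0, 1:] *v s = 0" "poly_mat G [:0, 1:] *v t = 0"
    using G by (simp_all only: poly_mat_linear) simp_all
  \<comment> \<open>As \<open>\<kappa> / 0 = 0\<close>, zero does not satisfy the inequality
    required of the roots.\<close>
  have "poly p 0 \<noteq> 0" "poly q 0 \<noteq> 0"
    using p(3)[of 0] q(3)[of 0] by auto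
  then have "coprime p [:0, 1:]" "coprime q [:0, 1:]"
    using p(1) q(1) by (auto intro!: coprime_complex_poly)
  then show ?thesis
    using coprime_poly_mat_kernel p(2) q(2) 0 by blast
qed

subsection \<open>The degree of a matrix pencil\<close>

lemma coeff_mult_top:
  fixes p q :: "'a::comm_ring_1 poly"
  assumes "degree p \<le> m" "degree q \<le> n"
  shows "coeff (p * q) (m + n) = coeff p m * coeff q n"
proof -
  have "coeff (p * q) (m + n) = (\<Sum>i\<le>m + n. coeff p i * coeff q (m + n - i))"
    by (rule coeff_mult)
  also have "\<dots> = (\<Sum>i\<le>m + n. if i = m then coeff p m * coeff q n else 0)"
  proof (rule sum.cong)
    fix i
    consider "i < m" | "i = m" | "i > m" by linarith
    then show "coeff p i * coeff q (m + n - i) = (if i = m then coeff p m * coeff q n else 0)"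
      using assms by cases (simp_all add: coeff_eq_0)
  qed simp
  finally show ?thesis by simp
qed

lemma coeff_prod_top:
  fixes f :: "'i \<Rightarrow> 'a::comm_ring_1 poly"
  assumes "finite I" "\<And>i. i \<in> I \<Longrightarrow> degree (f i) \<le> w i"
  shows "degree (prod f I) \<le> sum w I \<and> coeff (prod f I) (sum w I) = (\<Prod>i\<in>I. coeff (f i) (w i))"
  using assms
proof (induction I rule: finite_induct)
  case (insert i I)
  then have IH: "degree (prod f I) \<le> sum w I" "coeff (prod f I) (sum w I) = (\<Prod>i\<in>I. coeff (f i) (w i))"
    by auto
  have "degree (f i * prod f I) \<le> w i + sum w I"
    using IH(1) insert.prems[of i] degree_mult_le[of "f i" "prod f I"] by simp
  moreover have "coeff (f i * prod f I) (w i + sum w I) = coeff (f i) (w i) * (\<Prod>i\<in>I. coeff (f i) (w i))"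
    using IH insert.prems[of i] by (simp add: coeff_mult_top)
  ultimately show ?case using insert.hyps by simp
qed simp

text \<open>The bounds \<open>w\<close> depend on the column only, so every permutation in the
  Leibniz expansion has the same total bound, and the top coefficients again form a
  determinant.\<close>

lemma coeff_det_top:
  fixes P :: "('a::comm_ring_1 poly)^'n^'n"
  assumes "\<And>i j. degree (P $ i $ j) \<le> w j"
  shows "degree (det P) \<le> sum w UNIV"
    and "coeff (det P) (sum w UNIV) = det (\<chi> i j. coeff (P $ i $ j) (w j))"
proof -
  have *: "degree (\<Prod>i\<in>UNIV. P $ i $ p i) \<le> sum w UNIV \<and>
      coeff (\<Prod>i\<in>UNIV. P $ i $ p i) (sum w UNIV) = (\<Prod>i\<in>UNIV. coeff (P $ i $ p i) (w (p i)))"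
    if "p permutes UNIV" for p
  proof -
    have "sum w UNIV = (\<Sum>i\<in>UNIV. w (p i))"
      using sum.permute[OF that, of w] by (simp add: o_def)
    then show ?thesis
      using coeff_prod_top[of UNIV "\<lambda>i. P $ i $ p i" "\<lambda>i. w (p i)"] assms by simp
  qed
  show "degree (det P) \<le> sum w UNIV"
    unfolding det_def of_int_poly using * by (intro degree_sum_le) (auto intro!: order_trans[OF degree_smult_le])
  show "coeff (det P) (sum w UNIV) = det (\<chi> i j. coeff (P $ i $ j) (w j))"
    unfolding det_def of_int_poly using * by (simp add: coeff_sum)
qed

lemma det_map_const_poly:
  fixes Q :: "('a::comm_ring_1)^'n^'n"
  shows "det (map_matrix (\<lambda>c. [:c:]) Q) = [:det Q:]"
proof -
  have d: "degree (map_matrix (\<lambda>c. [:c:]) Q $ i $ j) \<le> (\<lambda>_. 0) j" for i j by simp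
  have Q: "(\<chi> i j. coeff (map_matrix (\<lambda>c. [:c:]) Q $ i $ j) 0) = Q" by (simp add: vec_eq_iff)
  have "degree (det (map_matrix (\<lambda>c. [:c:]) Q)) = 0" "coeff (det (map_matrix (\<lambda>c. [:c:]) Q)) 0 = det Q"
    using coeff_det_top[OF d] by (simp_all only: sum.neutral_const le_zero_eq Q)
  then show ?thesis by (metis degree_eq_zeroE coeff_pCons_0)
qed

text \<open>The columns of \<open>Q\<close> are a basis of the kernel of \<open>A\<close> extended
  to the whole space; \<open>J\<close> marks the columns taken from the kernel.\<close>

lemma kernel_adapted_basis:
  fixes A :: "complex^'n^'n"
  obtains Q :: "complex^'n^'n" and J :: "'n set" where "det Q \<noteq> 0"
    "\<And>c. A *v (Q *v c) = 0 \<longleftrightarrow> (\<forall>i. i \<notin> J \<longrightarrow> c $ i = 0)"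
proof -
  obtain B0 where B0: "B0 \<subseteq> {v. A *v v = 0}" "vec.independent B0" "{v. A *v v = 0} \<subseteq> vec.span B0"
    using vec.basis_exists by metis
  obtain B where B: "B0 \<subseteq> B" "vec.independent B" "UNIV \<subseteq> vec.span B"
    using vec.maximal_independent_subset_extend[of B0 UNIV] B0(2) by auto
  have fin: "finite B" using B(2) by (rule vec.finiteI_independent)
  have "card B = CARD('n)"
    using vec.basis_card_eq_dim[of B UNIV] B vec_dim_card by auto
  then obtain f :: "'n \<Rightarrow> complex^'n" where f: "bij_betw f UNIV B"
    using finite_same_card_bij[of "UNIV :: 'n set" B] fin by auto
  define Q where "Q = (\<chi> i j. f j $ i)"
  define J where "J = {j. f j \<in> B0}"
  have Qc: "Q *v c = (\<Sum>j\<in>UNIV. c $ j *s f j)" for c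
    by (simp add: Q_def vec_eq_iff matrix_vector_mult_def mult.commute)
  have inj: "c = 0" if "Q *v c = 0" for c
  proof -
    define u where "u b = c $ (inv_into UNIV f b)" for b
    have inv: "inv_into UNIV f (f j) = j" for j
      using f by (simp add: bij_betw_def)
    have "(\<Sum>b\<in>B. u b *s b) = (\<Sum>j\<in>UNIV. u (f j) *s f j)"
      using sum.reindex_bij_betw[OF f, of "\<lambda>b. u b *s b"] by simp
    also have "\<dots> = 0" using that by (simp add: Qc u_def inv)
    finally have "\<forall>b\<in>B. u b = 0"
      using B(2) fin by (auto simp: vec.dependent_finite)
    then have "u (f j) = 0" for j using f by (auto simp: bij_betw_def)
    then show ?thesis by (simp add: u_def inv vec_eq_iff)
  qed
  show thesis
  proof (rule that[of Q J])
    show "det Q \<noteq> 0"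
      by (metis inj det_zero_kernel)
    fix c
    show "A *v (Q *v c) = 0 \<longleftrightarrow> (\<forall>i. i \<notin> J \<longrightarrow> c $ i = 0)"
    proof
      assume c: "\<forall>i. i \<notin> J \<longrightarrow> c $ i = 0"
      have "c $ j *s (A *v f j) = 0" for j
        using c B0(1) by (cases "j \<in> J") (auto simp: J_def)
      then show "A *v (Q *v c) = 0"
        by (simp only: Qc linear_sum[OF matrix_vector_mul_linear] vector_scalar_commute sum.neutral_const)
    next
      assume "A *v (Q *v c) = 0"
      then have "Q *v c \<in> vec.span B0" using B0(3) by auto
      then obtain u where u: "Q *v c = (\<Sum>b\<in>B0. u b *s b)"
        using vec.span_finite[of B0] finite_subset[OF B(1) fin] by auto
      have "bij_betw f J B0"
        using f B(1) by (auto simp: J_def bij_betw_def inj_on_def)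
      then have "(\<Sum>b\<in>B0. u b *s b) = (\<Sum>j\<in>J. u (f j) *s f j)"
        using sum.reindex_bij_betw[of f J B0 "\<lambda>b. u b *s b"] by simp
      \<comment> \<open>Padding with zeros outside \<open>J\<close> gives a second coordinate vector
        with the same image under \<open>Q\<close>, which must then be \<open>c\<close>.\<close>
      also have "\<dots> = (\<Sum>j\<in>UNIV. if j \<in> J then u (f j) *s f j else 0)"
        by (simp add: sum.If_cases)
      also have "\<dots> = Q *v (\<chi> j. if j \<in> J then u (f j) else 0)"
        unfolding Qc by (intro sum.cong) auto
      finally have "Q *v (c - (\<chi> j. if j \<in> J then u (f j) else 0)) = 0"
        using u by (simp add: matrix_vector_mult_diff_distrib)
      from inj[OF this] show "\<forall>i. i \<notin> J \<longrightarrow> c $ i = 0"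
        by (simp add: vec_eq_iff)
    qed
  qed
qed

definition pencil :: "'a::comm_ring_1^'n^'n \<Rightarrow> 'a^'n^'n \<Rightarrow> ('a poly)^'n^'n" where
  "pencil A M = (\<chi> i j. [:M $ i $ j, A $ i $ j:])"

text \<open>
  Multiplied by \<open>Q\<close>, the columns of \<open>\<rho> A + M\<close> with index in \<open>J\<close> do not depend on \<open>\<rho>\<close>.  The degree of the
  determinant is thus at most the rank of \<open>A\<close>, and the coefficient of that power of \<open>\<rho>\<close> is \<open>det (K M)\<close> up to a
  nonzero factor.
\<close>

lemma pencil_degree_kernel_range:
  fixes A M :: "complex^'n^'n"
  assumes ss: "semisimple_at_zero A" and "\<tau> \<noteq> 0" and "det M \<noteq> 0"
    and deg: "degree (det (pencil A M)) = degree (det (pencil A (mat \<tau>)))"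
    and v: "A *v v = 0" "M *v v = A *v u"
  shows "v = 0"
proof -
  obtain Q J where Q: "det Q \<noteq> 0" "\<And>c. A *v (Q *v c) = 0 \<longleftrightarrow> (\<forall>i. i \<notin> J \<longrightarrow> c $ i = 0)"
    using kernel_adapted_basis[of A] by metis
  \<comment> \<open>The degree in \<rho> of column \<open>j\<close> after multiplication by
    \<open>Q\<close>; its sum is the number of columns outside the kernel, that is the rank of
    \<open>A\<close>.\<close>
  define w where "w j = (if j \<in> J then 0 else 1 :: nat)" for j
  define K where "K M = (\<chi> i j. if j \<in> J then (M ** Q) $ i $ j else (A ** Q) $ i $ j)" for M :: "complex^'n^'n"
  have AQ: "(A ** Q) $ i $ j = 0" if "j \<in> J" for i j
  proof -
    have "A *v (Q *v axis j 1) = 0" using that by (subst Q(2)) (auto simp: axis_def)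
    then have "((A ** Q) *v axis j 1) $ i = 0" by (simp add: matrix_vector_mul_assoc)
    then show ?thesis by (simp add: matrix_vector_mult_def axis_def if_distrib cong: if_cong)
  qed
  have PQ: "(pencil A M ** map_matrix (\<lambda>c. [:c:]) Q) $ i $ j = [:(M ** Q) $ i $ j, (A ** Q) $ i $ j:]"
    for M :: "complex^'n^'n" and i j
    by (rule poly_eqI)
       (auto simp: pencil_def matrix_matrix_mult_def coeff_sum coeff_pCons mult.commute split: nat.split)
  have d: "degree ((pencil A M ** map_matrix (\<lambda>c. [:c:]) Q) $ i $ j) \<le> w j" for M :: "complex^'n^'n" and i j
    unfolding PQ by (auto simp: AQ w_def)
  have K: "(\<chi> i j. coeff ((pencil A M ** map_matrix (\<lambda>c. [:c:]) Q) $ i $ j) (w j)) = K M"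
    for M :: "complex^'n^'n"
    unfolding PQ by (auto simp: K_def w_def vec_eq_iff)
  have detPQ: "det (pencil A M ** map_matrix (\<lambda>c. [:c:]) Q) = smult (det Q) (det (pencil A M))"
    for M :: "complex^'n^'n"
    by (simp add: det_mul det_map_const_poly)
  have top: "degree (det (pencil A M)) \<le> sum w UNIV"
    "det Q * coeff (det (pencil A M)) (sum w UNIV) = det (K M)" for M :: "complex^'n^'n"
    using coeff_det_top[OF d, of M] Q(1) unfolding K detPQ by simp_all
  have Kc: "K M *v c = M *v (Q *v (\<chi> j. if j \<in> J then c $ j else 0))
      + A *v (Q *v (\<chi> j. if j \<in> J then 0 else c $ j))" for M :: "complex^'n^'n" and c
    unfolding matrix_vector_mul_assoc
    by (simp add: vec_eq_iff matrix_vector_mult_def K_def sum.distrib[symmetric])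
       (auto intro!: sum.cong)
  have Q0: "c = 0" if "Q *v c = 0" for c
    using Q(1) that by (metis invertible_det_nz invertible_left_inverse matrix_left_invertible_ker)
  have "det (K (mat \<tau>)) \<noteq> 0"
  proof
    assume "det (K (mat \<tau>)) = 0"
    then obtain c where c: "c \<noteq> 0" "K (mat \<tau>) *v c = 0" by (rule det_zero_kernel)
    \<comment> \<open>Since \<open>Q x\<close> is in the kernel of \<open>A\<close>, applying
      \<open>A\<close> to the relation leaves \<open>A (A (Q y)) = 0\<close>, and semisimplicity
      yields \<open>A (Q y) = 0\<close>.\<close>
    define x y :: "complex^'n" where "x = (\<chi> j. if j \<in> J then c $ j else 0)" and "y = (\<chi> j. if j \<in> J then 0 else c $ j)"
    have *: "\<tau> *s (Q *v x) + A *v (Q *v y) = 0"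
      using c(2) by (simp add: Kc mat_mult_vec x_def y_def)
    have "A *v (Q *v x) = 0" by (subst Q(2)) (simp add: x_def)
    then have "A *v (A *v (Q *v y)) = 0"
      using arg_cong[OF *, of "\<lambda>v. A *v v"] by (simp add: matrix_vector_right_distrib vector_scalar_commute)
    then have y: "A *v (Q *v y) = 0" using ss by (simp add: semisimple_at_zero_def)
    with * \<open>\<tau> \<noteq> 0\<close> have "x = 0" by (auto intro: Q0 simp: vec.scale_eq_0_iff)
    moreover have "\<forall>i. i \<notin> J \<longrightarrow> y $ i = 0" using y by (simp only: Q(2))
    ultimately have "c = 0" by (auto simp: x_def y_def vec_eq_iff) metis
    with c(1) show False by simp
  qed
  then have "coeff (det (pencil A (mat \<tau>))) (sum w UNIV) \<noteq> 0"
    using top(2)[of "mat \<tau>"] by auto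
  then have "degree (det (pencil A (mat \<tau>))) = sum w UNIV"
    using top(1)[of "mat \<tau>"] le_degree by (intro antisym)
  with deg have deg: "degree (det (pencil A M)) = sum w UNIV" by simp
  have KM: "det (K M) \<noteq> 0"
  \<comment> \<open>The zero polynomial also has degree 0, so for \<open>A = 0\<close> the degree
    says nothing; there \<open>K M\<close> is just \<open>M ** Q\<close>.\<close>
  proof (cases "sum w UNIV = 0")
    case True
    then have "j \<in> J" for j by (auto simp: w_def split: if_splits)
    then have "K M = M ** Q" by (simp add: K_def vec_eq_iff)
    then show ?thesis using Q(1) assms(3) by (simp add: det_mul)
  next
    case False
    then have "det (pencil A M) \<noteq> 0" using deg by auto
    then show ?thesis using top(2)[of M] Q(1) deg leading_coeff_neq_0 by (metis mult_eq_0_iff)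
  qed
  obtain Q' where Q': "Q ** Q' = mat 1" using Q(1) unfolding invertible_det_nz[symmetric] invertible_def by blast
  define c d where "c = Q' *v v" and "d = Q' *v u"
  have c: "v = Q *v c" "u = Q *v d" by (simp_all add: c_def d_def matrix_vector_mul_assoc Q')
  have cN: "\<forall>i. i \<notin> J \<longrightarrow> c $ i = 0"
    using v(1) unfolding c(1) Q(2) .
  then have cJ: "(\<chi> j. if j \<in> J then c $ j else 0) = c"
    using cN by (auto simp: vec_eq_iff)
  \<comment> \<open>The entries of \<open>d\<close> in \<open>J\<close> do not contribute to
    \<open>A (Q d)\<close>. Hence \<open>K M\<close> maps \<open>x\<close> to
    \<open>M v - A u = 0\<close>.\<close>
  define x where "x = (\<chi> j. if j \<in> J then c $ j else - d $ j)"
  have "A *v (Q *v ((\<chi> j. if j \<in> J then 0 else x $ j) + d)) = 0"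
    by (subst Q(2)) (simp add: x_def)
  moreover have "(\<chi> j. if j \<in> J then x $ j else 0) = c"
    using cN by (simp add: x_def vec_eq_iff)
  ultimately have "K M *v x = 0"
    using v(2) by (simp add: Kc c matrix_vector_right_distrib) (metis add.commute)
  then have "x = 0"
    using KM by (metis invertible_det_nz invertible_left_inverse matrix_left_invertible_ker)
  then have "c = 0" using cN by (auto simp: x_def vec_eq_iff) metis
  then show ?thesis by (simp add: c)
qed

subsection \<open>The split operator\<close>

lemma mat_mult_component:
  fixes X :: "'a::semiring_1^'n^'n"
  shows "(mat c ** X) $ i $ j = c * X $ i $ j"
  by (simp add: matrix_matrix_mult_def mat_def if_distrib[of "\<lambda>x. x * _"] cong: if_cong)

lemma kernel_det_zero:
  fixes M :: "complex^'m^'m"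
  assumes "M *v v = 0" "v \<noteq> 0"
  shows "det M = 0"
  using assms by (metis invertible_det_nz invertible_left_inverse matrix_left_invertible_ker)

text \<open>As \<eta> is tangential, \<open>A e\<close> enters only through the indeterminate and
  all other terms are constant in it.\<close>

lemma normal_poly_pencil:
  fixes A :: "'d::finite \<Rightarrow> complex^'n^'n" and \<eta> :: "real^'d"
  assumes "\<eta> \<in> tangential e"
  shows "normal_poly A 0 e \<tau> \<eta> = det (pencil (A e) (symbol A 0 \<tau> (\<chi> l. \<i> * complex_of_real (\<eta> $ l))))"
proof -
  have \<eta>: "\<eta> $ e = 0" using assms by (simp add: tangential_def)
  have "coeff (symbol (\<lambda>l. map_matrix (\<lambda>c. [:c:]) (A l)) (map_matrix (\<lambda>c. [:c:]) 0) [:\<tau>:]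
       (\<chi> l. if l = e then [:0, 1:] else [:\<i> * complex_of_real (\<eta> $ l):]) $ i $ j) n =
    coeff (pencil (A e) (symbol A 0 \<tau> (\<chi> l. \<i> * complex_of_real (\<eta> $ l))) $ i $ j) n" for i j n
  proof -
    have "(\<Sum>l\<in>UNIV. coeff ((if l = e then [:0, 1:] else [:\<i> * complex_of_real (\<eta> $ l):]) * [:A l $ i $ j:]) n) =
       (\<Sum>l\<in>UNIV. coeff [:\<i> * complex_of_real (\<eta> $ l) * A l $ i $ j, if l = e then A e $ i $ j else 0:] n)"
      by (intro sum.cong) (auto simp: \<eta> coeff_pCons mult.commute split: nat.split)
    also have "\<dots> = coeff [:\<Sum>l\<in>UNIV. \<i> * complex_of_real (\<eta> $ l) * A l $ i $ j, A e $ i $ j:] n"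
      by (simp add: coeff_pCons split: nat.split)
    finally show ?thesis
      by (simp add: symbol_def pencil_def mat_mult_component coeff_sum)
         (simp add: mat_def coeff_pCons split: nat.split)
  qed
  then show ?thesis
    unfolding normal_poly_def by (intro arg_cong[where f = det]) (simp add: vec_eq_iff poly_eq_iff)
qed

section \<open>Reduction of the split equation to the sum of the blocks\<close>

lemma bounded_linear_block_sum: "bounded_linear block_sum"
  unfolding linear_conv_bounded_linear[symmetric]
  by (rule linearI) (simp_all add: block_sum_def vec_eq_iff sum.distrib scaleR_sum_right)

lemma split_symbol_component:
  fixes A :: "'d::finite \<Rightarrow> complex^'n^'n" and \<zeta> :: "complex^'d"
  shows "(symbol (split_coeff A) (absorption e \<sigma>) \<tau> \<zeta> *v w) $ (k, a) =
     \<tau> * w $ (k, a) + \<zeta> $ k * (A k *v block_sum w) $ a + (if k = e then of_real \<sigma> * w $ (k, a) else 0)"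
proof -
  have "(\<Sum>l\<in>UNIV. \<zeta> $ l *s (split_coeff A l *v w)) $ (k, a) =
      (\<Sum>l\<in>UNIV. if k = l then \<zeta> $ l * (A l *v block_sum w) $ a else 0)"
    by (simp add: split_coeff_mult if_distrib [of "\<lambda>x. _ * x"] cong: if_cong)
  then show ?thesis
    by (simp add: symbol_mult absorption_mult)
qed

text \<open>Recovers the blocks from their sum \<open>s\<close>: those other than \<open>e\<close>
  solve \<open>\<tau> W\<^sub>l + \<zeta>\<^sub>l A\<^sub>l s = 0\<close>, and, when
  \<open>\<zeta> $ e = 0\<close>, block \<open>e\<close> is what remains of
  \<open>s\<close>.\<close>

definition block_lift ::
    "('d::finite \<Rightarrow> complex^'n^'n) \<Rightarrow> 'd \<Rightarrow> complex \<Rightarrow> complex^'d \<Rightarrow> complex^'n \<Rightarrow> complex^('d \<times> 'n)" where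
  "block_lift A e \<tau> \<zeta> s = (\<chi> p. if fst p = e then (symbol A 0 \<tau> \<zeta> *v s) $ snd p / \<tau>
     else - \<zeta> $ fst p * (A (fst p) *v s) $ snd p / \<tau>)"

lemma bounded_linear_block_lift: "bounded_linear (block_lift A e \<tau> \<zeta>)"
  unfolding linear_conv_bounded_linear[symmetric]
  by (rule linearI)
     (auto simp: block_lift_def vec_eq_iff matrix_vector_right_distrib algebra_simps add_divide_distrib
        diff_divide_distrib scaleR_conv_of_real[where 'a = complex] linear_cmul[OF matrix_vector_mul_linear])

lemma block_sum_component:
  fixes w :: "complex^('d::finite \<times> 'n::finite)"
  shows "block_sum w $ a = w $ (e, a) + (\<Sum>k\<in>- {e}. w $ (k, a))"
  by (simp add: block_sum_def sum.remove[of UNIV e] Compl_eq_Diff_UNIV)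

lemma symbol_component_tangential:
  fixes A :: "'d::finite \<Rightarrow> complex^'n^'n" and \<zeta> :: "complex^'d"
  assumes "\<zeta> $ e = 0"
  shows "(symbol A 0 \<tau> \<zeta> *v s) $ a = \<tau> * s $ a + (\<Sum>k\<in>- {e}. \<zeta> $ k * (A k *v s) $ a)"
  using assms by (simp add: symbol_mult sum.remove[of UNIV e] Compl_eq_Diff_UNIV)

lemma block_sum_block_lift:
  fixes A :: "'d::finite \<Rightarrow> complex^'n^'n" and \<zeta> :: "complex^'d"
  assumes "\<zeta> $ e = 0" "\<tau> \<noteq> 0"
  shows "block_sum (block_lift A e \<tau> \<zeta> s) = s"
proof -
  have "block_sum (block_lift A e \<tau> \<zeta> s) $ a = s $ a" for a
    using assms(2)
    by (simp add: block_sum_component[of _ _ e] block_lift_def symbol_component_tangential[OF assms(1)]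
        sum_negf sum_divide_distrib[symmetric] add_divide_distrib)
  then show ?thesis by (simp add: vec_eq_iff)
qed

text \<open>The rows other than \<open>e\<close> contain no derivative and determine their blocks
  from the sum; block \<open>e\<close> follows by subtraction. Row \<open>e\<close> then becomes an
  equation for the sums alone, and \<sigma> survives only in its scalar factor.\<close>

lemma split_resolvent_iff:
  fixes A :: "'d::finite \<Rightarrow> complex^'n^'n" and \<zeta> :: "complex^'d"
  assumes "\<zeta> $ e = 0" "\<tau> \<noteq> 0"
  shows "split_coeff A e *v w' + symbol (split_coeff A) (absorption e \<sigma>) \<tau> \<zeta> *v w = 0 \<longleftrightarrow>
    w = block_lift A e \<tau> \<zeta> (block_sum w) \<and>
    A e *v block_sum w' + ((\<tau> + of_real \<sigma>) / \<tau>) *s (symbol A 0 \<tau> \<zeta> *v block_sum w) = 0"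
    (is "?L \<longleftrightarrow> ?R1 \<and> ?R2")
proof -
  let ?s = "block_sum w"
  have "?L \<longleftrightarrow> (\<forall>k a. (if k = e then (A e *v block_sum w') $ a else 0) +
      (\<tau> * w $ (k, a) + \<zeta> $ k * (A k *v ?s) $ a + (if k = e then of_real \<sigma> * w $ (k, a) else 0)) = 0)"
    by (simp add: vec_eq_iff[of _ "0 :: complex^_"] split_coeff_mult split_symbol_component)
  also have "\<dots> \<longleftrightarrow> (\<forall>a. (A e *v block_sum w') $ a + (\<tau> + of_real \<sigma>) * w $ (e, a) = 0) \<and>
      (\<forall>k a. k \<noteq> e \<longrightarrow> w $ (k, a) = - \<zeta> $ k * (A k *v ?s) $ a / \<tau>)"
  proof -
    have "\<tau> * w $ (k, a) + \<zeta> $ k * x = 0 \<longleftrightarrow> w $ (k, a) = - \<zeta> $ k * x / \<tau>" for k a x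
      unfolding nonzero_eq_divide_eq[OF \<open>\<tau> \<noteq> 0\<close>] by (simp add: eq_neg_iff_add_eq_0 mult.commute)
    moreover have "x + (\<tau> * y + \<zeta> $ e * z + of_real \<sigma> * y) = 0 \<longleftrightarrow> x + (\<tau> + of_real \<sigma>) * y = 0" for x y z
      by (simp add: assms(1) distrib_right)
    ultimately show ?thesis by (smt (verit) add_0 add.right_neutral)
  qed
  also have "\<dots> \<longleftrightarrow> ?R1 \<and> ?R2"
  proof -
    have R1: "?R1 \<longleftrightarrow> (\<forall>k a. k \<noteq> e \<longrightarrow> w $ (k, a) = - \<zeta> $ k * (A k *v ?s) $ a / \<tau>)" (is "_ \<longleftrightarrow> ?T")
    proof
      assume T: ?T
      have "\<tau> * w $ (e, a) = (symbol A 0 \<tau> \<zeta> *v ?s) $ a" for a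
      proof -
        have "(\<Sum>k\<in>-{e}. \<zeta> $ k * (A k *v ?s) $ a) = - \<tau> * (\<Sum>k\<in>-{e}. w $ (k, a))"
          unfolding sum_distrib_left using T assms(2) by (intro sum.cong) auto
        then show ?thesis
          by (simp add: symbol_component_tangential[OF assms(1)] block_sum_component[of _ a e] algebra_simps)
      qed
      then have "w $ (e, a) = (symbol A 0 \<tau> \<zeta> *v ?s) $ a / \<tau>" for a
        using assms(2) by (simp add: field_simps)
      with T show ?R1 by (auto simp: block_lift_def vec_eq_iff)
    next
      assume R: ?R1
      show ?T
      proof (intro allI impI)
        fix k a assume "k \<noteq> e"
        then show "w $ (k, a) = - \<zeta> $ k * (A k *v ?s) $ a / \<tau>"
          using arg_cong[OF R, of "\<lambda>v. v $ (k, a)"] by (simp add: block_lift_def)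
      qed
    qed
    have "w $ (e, a) = (symbol A 0 \<tau> \<zeta> *v ?s) $ a / \<tau>" if ?R1 for a
      using arg_cong[OF that, of "\<lambda>v. v $ (e, a)"] by (simp add: block_lift_def)
    then have "(\<forall>a. (A e *v block_sum w') $ a + (\<tau> + of_real \<sigma>) * w $ (e, a) = 0) \<longleftrightarrow> ?R2" if ?R1
      using that by (simp add: vec_eq_iff[of _ "0 :: complex^_"])
    with R1 show ?thesis by blast
  qed
  finally show ?thesis .
qed

text \<open>On solutions \<open>block_sum\<close> and \<open>block_lift\<close> are mutually
  inverse; both are bounded linear, hence compatible with derivatives and with limits along any
  filter.\<close>

lemma decaying_values_split:
  fixes A :: "'d::finite \<Rightarrow> complex^'n^'n" and \<eta> :: "real^'d" and \<sigma> :: real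
  assumes \<eta>: "\<eta> \<in> tangential e" and "\<tau> \<noteq> 0"
  defines "\<zeta> \<equiv> \<chi> l. \<i> * complex_of_real (\<eta> $ l)"
  defines "M \<equiv> symbol A 0 \<tau> \<zeta>"
  assumes G: "M ** G = A e" "det M \<noteq> 0"
  defines "\<kappa> \<equiv> (\<tau> + of_real \<sigma>) / \<tau>"
  shows "decaying_values F (split_coeff A) (absorption e \<sigma>) e \<tau> \<eta> =
    block_lift A e \<tau> \<zeta> ` {Z 0 | Z Z'. (\<forall>x. (Z has_vector_derivative Z' x) (at x)) \<and>
       (\<forall>x. G *v Z' x = - \<kappa> *s Z x) \<and> (Z \<longlongrightarrow> 0) F}" (is "?L = _ ` ?R")
proof -
  have \<zeta>: "\<zeta> $ e = 0" using \<eta> by (simp add: \<zeta>_def tangential_def)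
  have ode: "A e *v s' + \<kappa> *s (M *v s) = 0 \<longleftrightarrow> G *v s' = - \<kappa> *s s" for s s'
  proof -
    have "A e *v s' + \<kappa> *s (M *v s) = M *v (G *v s' + \<kappa> *s s)"
      by (simp add: matrix_vector_mul_assoc G matrix_vector_right_distrib vector_scalar_commute)
    also have "\<dots> = 0 \<longleftrightarrow> G *v s' + \<kappa> *s s = 0"
      using kernel_det_zero[of M] G(2) by auto
    finally show ?thesis by (simp add: eq_neg_iff_add_eq_0 vector_smult_lneg)
  qed
  note res = split_resolvent_iff[where \<zeta> = \<zeta>, OF \<zeta> \<open>\<tau> \<noteq> 0\<close>, of A _ \<sigma>, folded M_def \<kappa>_def, unfolded ode]
  show ?thesis
  proof (intro equalityI subsetI)
    fix w assume "w \<in> ?L"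
    then obtain Z Z' where w: "w = Z 0" and Z: "\<And>x. (Z has_vector_derivative Z' x) (at x)"
        "\<And>x. split_coeff A e *v Z' x + symbol (split_coeff A) (absorption e \<sigma>) \<tau> \<zeta> *v Z x = 0"
        "(Z \<longlongrightarrow> 0) F"
      unfolding decaying_values_def \<zeta>_def by auto
    have "((\<lambda>x. block_sum (Z x)) \<longlongrightarrow> 0) F"
      using bounded_linear.tendsto[OF bounded_linear_block_sum Z(3)]
      by (simp add: linear_0[OF bounded_linear.linear[OF bounded_linear_block_sum]])
    then have "block_sum (Z 0) \<in> ?R"
      using bounded_linear.has_vector_derivative[OF bounded_linear_block_sum Z(1)] Z(2) unfolding res
      by (intro CollectI exI[of _ "\<lambda>x. block_sum (Z x)"] exI[of _ "\<lambda>x. block_sum (Z' x)"]) blast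
    moreover have "w = block_lift A e \<tau> \<zeta> (block_sum (Z 0))"
      using Z(2) unfolding res w by blast
    ultimately show "w \<in> block_lift A e \<tau> \<zeta> ` ?R" by blast
  next
    fix w assume "w \<in> block_lift A e \<tau> \<zeta> ` ?R"
    then obtain S S' where w: "w = block_lift A e \<tau> \<zeta> (S 0)" and S:
        "\<And>x. (S has_vector_derivative S' x) (at x)" "\<And>x. G *v S' x = - \<kappa> *s S x" "(S \<longlongrightarrow> 0) F"
      by blast
    define Z Z' where "Z x = block_lift A e \<tau> \<zeta> (S x)" and "Z' x = block_lift A e \<tau> \<zeta> (S' x)" for x
    have "(Z \<longlongrightarrow> 0) F"
      unfolding Z_def using bounded_linear.tendsto[OF bounded_linear_block_lift S(3)]
      by (simp add: linear_0[OF bounded_linear.linear[OF bounded_linear_block_lift]])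
    moreover have "(Z has_vector_derivative Z' x) (at x)" for x
      unfolding Z_def Z'_def by (rule bounded_linear.has_vector_derivative[OF bounded_linear_block_lift S(1)])
    moreover have "split_coeff A e *v Z' x + symbol (split_coeff A) (absorption e \<sigma>) \<tau> \<zeta> *v Z x = 0" for x
      unfolding res by (simp add: Z_def Z'_def block_sum_block_lift[where \<zeta> = \<zeta>, OF \<zeta> \<open>\<tau> \<noteq> 0\<close>] S(2))
    ultimately show "w \<in> ?L"
      unfolding decaying_values_def w \<zeta>_def[symmetric]
      by (intro CollectI exI[of _ Z] exI[of _ Z']) (auto simp: Z_def)
  qed
qed

lemma decaying_data_at_top:
  "decaying_data G \<kappa> = {Z 0 | Z Z'. (\<forall>x. (Z has_vector_derivative Z' x) (at x)) \<and>
       (\<forall>x. G *v Z' x = - \<kappa> *s Z x) \<and> (Z \<longlongrightarrow> 0) at_top}"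
  by (auto simp: decaying_data_def decaying_solution_def)

text \<open>The reflection of \<open>x\<close> changes the sign of the derivative, hence of
  \<kappa>.\<close>

lemma decaying_data_at_bot:
  "decaying_data G (- \<kappa>) = {Z 0 | Z Z'. (\<forall>x. (Z has_vector_derivative Z' x) (at x)) \<and>
       (\<forall>x. G *v Z' x = - \<kappa> *s Z x) \<and> (Z \<longlongrightarrow> 0) at_bot}" (is "_ = ?R")
proof -
  have mirror: "((\<lambda>x. Z (- x)) has_vector_derivative - Z' (- x)) (at x)"
    if "\<And>x. (Z has_vector_derivative Z' x) (at x)" for Z Z' :: "real \<Rightarrow> complex^'a" and x
  proof -
    have "(uminus has_vector_derivative - 1) (at x)"
      by (auto intro!: derivative_eq_intros)
    from vector_diff_chain_at[OF this that] show ?thesis by (simp add: o_def)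
  qed
  show ?thesis
  proof (intro equalityI subsetI)
    fix s assume "s \<in> decaying_data G (- \<kappa>)"
    then obtain Z Z' where s: "s = Z 0" and Z: "\<And>x. (Z has_vector_derivative Z' x) (at x)"
      "\<And>x. G *v Z' x = \<kappa> *s Z x" "(Z \<longlongrightarrow> 0) at_top"
      unfolding decaying_data_at_top by auto
    show "s \<in> ?R"
      by (rule CollectI, rule exI[of _ "\<lambda>x. Z (- x)"], rule exI[of _ "\<lambda>x. - Z' (- x)"])
         (use mirror[OF Z(1)] Z(2,3) in
           \<open>simp add: s filterlim_at_bot_mirror vec.neg vector_smult_lneg\<close>)
  next
    fix s assume "s \<in> ?R"
    then obtain Z Z' where s: "s = Z 0" and Z: "\<And>x. (Z has_vector_derivative Z' x) (at x)"
      "\<And>x. G *v Z' x = - \<kappa> *s Z x" "(Z \<longlongrightarrow> 0) at_bot"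
      by auto
    show "s \<in> decaying_data G (- \<kappa>)"
      unfolding decaying_data_at_top
      by (rule CollectI, rule exI[of _ "\<lambda>x. Z (- x)"], rule exI[of _ "\<lambda>x. - Z' (- x)"])
         (use mirror[OF Z(1)] Z(2,3) in
           \<open>simp add: s filterlim_at_top_mirror vec.neg vector_smult_lneg\<close>)
  qed
qed

subsection \<open>Absence of imaginary modes\<close>

text \<open>An imaginary value would make the lift of \<open>v\<close> a kernel vector of the split
  symbol at \<open>\<tau> / r\<close> and a real frequency. As \<open>r \<le> 1\<close>, the real
  part of \<open>\<tau> / r\<close> still exceeds \<open>m\<close>.\<close>

lemma split_mode_not_imaginary:
  fixes A :: "'d::finite \<Rightarrow> complex^'n^'n" and \<eta> :: "real^'d" and \<sigma> r :: real
  defines "M \<equiv> \<lambda>\<tau> \<eta>. symbol A 0 \<tau> (\<chi> l. \<i> * complex_of_real (\<eta> $ l))"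
  assumes m: "\<forall>\<tau> \<xi>. det (symbol (split_coeff A) (absorption e \<sigma>) \<tau> (\<chi> l. \<i> * complex_of_real (\<xi> $ l))) = 0 \<longrightarrow> \<bar>Re \<tau>\<bar> \<le> m"
    and \<tau>: "Re \<tau> > m" "Re \<tau> > 0" and \<eta>: "\<eta> \<in> tangential e"
    and r: "0 < r" "r \<le> 1"
    and v: "v \<noteq> 0" "A e *v v = \<mu> *s (M \<tau> \<eta> *v v)" "\<mu> \<noteq> 0"
  shows "Re ((1 + of_real r * of_real \<sigma> / \<tau>) / \<mu>) \<noteq> 0"
proof
  define c where "c = (1 + of_real r * of_real \<sigma> / \<tau>) / \<mu>"
  assume "Re ((1 + of_real r * of_real \<sigma> / \<tau>) / \<mu>) = 0"
  then have c: "\<i> * of_real (Im c) = c" by (simp add: c_def[symmetric] complex_eq_iff)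
  have "\<tau> \<noteq> 0" using \<tau>(2) by auto
  define \<zeta> where "\<zeta> = (\<chi> l. \<i> * complex_of_real (\<eta> $ l))"
  \<comment> \<open>Homogeneity: absorption \<open>r * \<sigma>\<close> at \<tau> amounts to
    absorption \<sigma> at \<open>\<tau> / r\<close>, with all frequencies divided by
    \<open>r\<close>. The normal entry is chosen so that
    \<open>\<i> * \<xi> $ e = - c / r\<close>.\<close>
  define \<xi> where "\<xi> = (\<chi> l. if l = e then - Im c / r else \<eta> $ l / r)"
  have \<zeta>e: "\<zeta> $ e = 0" using \<eta> by (simp add: \<zeta>_def tangential_def)
  define w where "w = block_lift A e \<tau> \<zeta> v"
  have bw: "block_sum w = v" by (simp add: w_def block_sum_block_lift[OF \<zeta>e \<open>\<tau> \<noteq> 0\<close>])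
  have Me: "(\<tau> + of_real r * of_real \<sigma>) * w $ (e, a) = c * (A e *v v) $ a" for a
  proof -
    have "c * \<mu> = 1 + of_real r * of_real \<sigma> / \<tau>"
      using v(3) by (simp add: c_def)
    also have "\<dots> = (\<tau> + of_real r * of_real \<sigma>) / \<tau>"
      using \<open>\<tau> \<noteq> 0\<close> by (simp add: add_divide_distrib)
    finally have "c * \<mu> = (\<tau> + of_real r * of_real \<sigma>) / \<tau>" .
    then have "c * (A e *v v) $ a = (\<tau> + of_real r * of_real \<sigma>) / \<tau> * (M \<tau> \<eta> *v v) $ a"
      unfolding v(2) vector_smult_component by (simp only: mult.assoc[symmetric])
    then show ?thesis by (simp add: w_def block_lift_def M_def \<zeta>_def)
  qed
  have "(symbol (split_coeff A) (absorption e \<sigma>) (\<tau> / of_real r) (\<chi> l. \<i> * complex_of_real (\<xi> $ l)) *v w) $ (k, a) = 0"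
    for k a
  proof (cases "k = e")
    case True
    have "of_real r * (\<tau> / of_real r * w $ (e, a) - c / of_real r * (A e *v v) $ a + of_real \<sigma> * w $ (e, a)) =
        (\<tau> + of_real r * of_real \<sigma>) * w $ (e, a) - c * (A e *v v) $ a"
      using r by (simp add: field_simps)
    then have "\<tau> / of_real r * w $ (e, a) - c / of_real r * (A e *v v) $ a + of_real \<sigma> * w $ (e, a) = 0"
      using r by (simp only: Me) simp
    moreover have "\<i> * complex_of_real (\<xi> $ e) = - (c / of_real r)"
      by (subst c[symmetric]) (simp add: \<xi>_def)
    ultimately show ?thesis
      unfolding split_symbol_component bw by (simp add: True)
  next
    case False
    then have "\<i> * complex_of_real (\<xi> $ k) = \<zeta> $ k / of_real r" "\<tau> * w $ (k, a) = - \<zeta> $ k * (A k *v v) $ a"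
      using \<open>\<tau> \<noteq> 0\<close> by (simp_all add: \<xi>_def \<zeta>_def w_def block_lift_def)
    then show ?thesis
      unfolding split_symbol_component bw using False by (simp add: add_divide_distrib[symmetric])
  qed
  then have "symbol (split_coeff A) (absorption e \<sigma>) (\<tau> / of_real r) (\<chi> l. \<i> * complex_of_real (\<xi> $ l)) *v w = 0"
    by (simp add: vec_eq_iff)
  moreover have "w \<noteq> 0"
    using bw v(1) linear_0[OF bounded_linear.linear[OF bounded_linear_block_sum]] by auto
  ultimately have "\<bar>Re (\<tau> / of_real r)\<bar> \<le> m" by (intro m[rule_format] kernel_det_zero)
  moreover have "Re \<tau> \<le> Re \<tau> / r" using r \<tau>(2) by (simp add: field_simps)
  ultimately show False using \<tau> r(1) by simp
qed

text \<open>The endpoint \<open>r = 0\<close> of the preceding lemma, where rescaling is impossible;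
  the hyperbolicity of the unsplit operator replaces it.\<close>

lemma mode_not_imaginary:
  fixes A :: "'d::finite \<Rightarrow> complex^'n^'n" and \<eta> :: "real^'d"
  defines "M \<equiv> \<lambda>\<tau> \<eta>. symbol A 0 \<tau> (\<chi> l. \<i> * complex_of_real (\<eta> $ l))"
  assumes m: "\<forall>\<tau> \<xi>. det (M \<tau> \<xi>) = 0 \<longrightarrow> \<bar>Re \<tau>\<bar> \<le> m"
    and \<tau>: "Re \<tau> > m" and \<eta>: "\<eta> \<in> tangential e"
    and v: "v \<noteq> 0" "A e *v v = \<mu> *s (M \<tau> \<eta> *v v)" "\<mu> \<noteq> 0"
  shows "Re (1 / \<mu>) \<noteq> 0"
proof
  assume "Re (1 / \<mu>) = 0"
  then have c: "\<i> * of_real (Im (1 / \<mu>)) = 1 / \<mu>" by (simp add: complex_eq_iff)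
  define \<xi> where "\<xi> = (\<chi> l. if l = e then - Im (1 / \<mu>) else \<eta> $ l)"
  have "\<i> * complex_of_real (\<xi> $ l) *s (A l *v v) =
      \<i> * complex_of_real (\<eta> $ l) *s (A l *v v) + (if l = e then - (1 / \<mu>) *s (A e *v v) else 0)" for l
  proof (cases "l = e")
    case True
    have "\<i> * complex_of_real (\<xi> $ e) = - (1 / \<mu>)"
      by (subst c[symmetric]) (simp add: \<xi>_def)
    then show ?thesis using \<eta> True by (simp add: tangential_def)
  qed (simp add: \<xi>_def)
  then have "M \<tau> \<xi> *v v = M \<tau> \<eta> *v v - (1 / \<mu>) *s (A e *v v)"
    by (simp add: M_def symbol_mult sum.distrib vector_smult_lneg)
  also have "\<dots> = 0" using v(2,3) by (simp add: vector_smult_assoc)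
  finally have "\<bar>Re \<tau>\<bar> \<le> m" using v(1) by (intro m[rule_format] kernel_det_zero)
  then show False using \<tau> by simp
qed

text \<open>A change of sign would put the zero \<open>- a / b\<close> into the unit
  interval.\<close>

lemma affine_sign_constant:
  fixes a b :: real
  assumes "\<And>s. 0 \<le> s \<Longrightarrow> s \<le> 1 \<Longrightarrow> a + s * b \<noteq> 0"
  shows "0 < a \<longleftrightarrow> 0 < a + b"
proof (rule ccontr)
  assume n: "\<not> ?thesis"
  have "a \<noteq> 0" "a + b \<noteq> 0" using assms[of 0] assms[of 1] by auto
  with n have "(a > 0 \<and> a + b < 0) \<or> (a < 0 \<and> a + b > 0)" by auto
  then have "0 \<le> - a / b" "- a / b \<le> 1" "b \<noteq> 0" by (auto simp: field_simps)
  with assms[of "- a / b"] show False by simp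
qed

text \<open>\<open>Re ((1 + s \<sigma> / \<tau>) / \<mu>)\<close> is affine in \<open>s\<close>,
  joins the two real parts in question, and has no zero for \<open>0 \<le> s \<le> 1\<close> by the
  two preceding exclusions of imaginary modes.\<close>

lemma split_mode_sign:
  fixes A :: "'d::finite \<Rightarrow> complex^'n^'n" and \<eta> :: "real^'d" and \<sigma> :: real
  defines "M \<equiv> \<lambda>\<tau> \<eta>. symbol A 0 \<tau> (\<chi> l. \<i> * complex_of_real (\<eta> $ l))"
  assumes m\<^sub>0: "\<forall>\<tau> \<xi>. det (M \<tau> \<xi>) = 0 \<longrightarrow> \<bar>Re \<tau>\<bar> \<le> m\<^sub>0"
    and m: "\<forall>\<tau> \<xi>. det (symbol (split_coeff A) (absorption e \<sigma>) \<tau> (\<chi> l. \<i> * complex_of_real (\<xi> $ l))) = 0 \<longrightarrow> \<bar>Re \<tau>\<bar> \<le> m"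
    and \<tau>: "Re \<tau> > m\<^sub>0" "Re \<tau> > m" "Re \<tau> > 0" and \<eta>: "\<eta> \<in> tangential e"
    and v: "v \<noteq> 0" "A e *v v = \<mu> *s (M \<tau> \<eta> *v v)" "\<mu> \<noteq> 0"
  shows "Re ((\<tau> + of_real \<sigma>) / \<tau> / \<mu>) \<noteq> 0"
    and "0 < Re ((\<tau> + of_real \<sigma>) / \<tau> / \<mu>) \<longleftrightarrow> 0 < Re (1 / \<mu>)"
proof -
  have "\<tau> \<noteq> 0" using \<tau>(3) by auto
  define b where "b = Re (of_real \<sigma> / (\<tau> * \<mu>))"
  have f: "Re (1 / \<mu>) + s * b = Re ((1 + of_real s * of_real \<sigma> / \<tau>) / \<mu>)" for s :: real
  proof -
    have "(1 + of_real s * of_real \<sigma> / \<tau>) / \<mu> = 1 / \<mu> + of_real s * (of_real \<sigma> / (\<tau> * \<mu>))"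
      by (simp add: add_divide_distrib)
    then show ?thesis unfolding b_def
      by (simp only: plus_complex.sel times_complex.sel Re_complex_of_real Im_complex_of_real mult_zero_left diff_0_right)
  qed
  have ne: "Re (1 / \<mu>) + s * b \<noteq> 0" if "0 \<le> s" "s \<le> 1" for s
  proof (cases "s = 0")
    case True
    then show ?thesis
      using mode_not_imaginary[OF m\<^sub>0[unfolded M_def] \<tau>(1) \<eta> v(1) v(2)[unfolded M_def] v(3)] by simp
  next
    case False
    then show ?thesis
      unfolding f using that
      by (intro split_mode_not_imaginary[OF m \<tau>(2,3) \<eta> _ _ v(1) v(2)[unfolded M_def] v(3)]) auto
  qed
  have \<kappa>: "Re ((\<tau> + of_real \<sigma>) / \<tau> / \<mu>) = Re (1 / \<mu>) + b"
    using f[of 1] \<open>\<tau> \<noteq> 0\<close> by (simp add: add_divide_distrib)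
  show "Re ((\<tau> + of_real \<sigma>) / \<tau> / \<mu>) \<noteq> 0" using ne[of 1] \<kappa> by simp
  show "0 < Re ((\<tau> + of_real \<sigma>) / \<tau> / \<mu>) \<longleftrightarrow> 0 < Re (1 / \<mu>)"
    unfolding \<kappa> using affine_sign_constant[OF ne] by simp
qed

section \<open>Hersh's condition for the split transmission problem\<close>

theorem theorem4p3:
  fixes A :: "'d::finite \<Rightarrow> complex^'n^'n"
    and e :: 'd
    and \<sigma>\<^sub>m \<sigma>\<^sub>p :: real
  assumes hyperbolic: "weakly_hyperbolic A 0"
    and nondegenerate: "nondegenerate A 0 e"
    and semisimple: "semisimple_at_zero (A e)"
    and split_minus: "weakly_hyperbolic (split_coeff A) (absorption e \<sigma>\<^sub>m)"
    and split_plus: "weakly_hyperbolic (split_coeff A) (absorption e \<sigma>\<^sub>p)"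
  shows "Hersh_condition (split_coeff A) e (absorption e \<sigma>\<^sub>m) (absorption e \<sigma>\<^sub>p)"
proof -
  define \<zeta> where "\<zeta> \<eta> = (\<chi> l. \<i> * complex_of_real (\<eta> $ l))" for \<eta> :: "real^'d"
  define M where "M \<tau> \<eta> = symbol A 0 \<tau> (\<zeta> \<eta>)" for \<tau> \<eta>
  obtain m where m: "\<forall>\<tau> \<xi>. det (M \<tau> \<xi>) = 0 \<longrightarrow> \<bar>Re \<tau>\<bar> \<le> m"
    using hyperbolic unfolding weakly_hyperbolic_def M_def \<zeta>_def by blast
  obtain m\<^sub>m where m\<^sub>m: "\<forall>\<tau> \<xi>. det (symbol (split_coeff A) (absorption e \<sigma>\<^sub>m) \<tau> (\<zeta> \<xi>)) = 0 \<longrightarrow> \<bar>Re \<tau>\<bar> \<le> m\<^sub>m"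
    using split_minus unfolding weakly_hyperbolic_def \<zeta>_def by blast
  obtain m\<^sub>p where m\<^sub>p: "\<forall>\<tau> \<xi>. det (symbol (split_coeff A) (absorption e \<sigma>\<^sub>p) \<tau> (\<zeta> \<xi>)) = 0 \<longrightarrow> \<bar>Re \<tau>\<bar> \<le> m\<^sub>p"
    using split_plus unfolding weakly_hyperbolic_def \<zeta>_def by blast
  obtain \<tau>\<^sub>1 k where \<tau>\<^sub>1: "\<tau>\<^sub>1 > 0"
    "\<And>\<tau> \<eta>. \<eta> \<in> tangential e \<Longrightarrow> Re \<tau> > \<tau>\<^sub>1 \<Longrightarrow> degree (normal_poly A 0 e \<tau> \<eta>) = k"
    using nondegenerate unfolding nondegenerate_def by blast
  \<comment> \<open>The absolute values of the absorptions ensure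
    \<open>Re (\<tau> + \<sigma>) > 0\<close>, so that neither \<kappa> vanishes.\<close>
  define \<tau>\<^sub>0 where "\<tau>\<^sub>0 = Max {m, m\<^sub>m, m\<^sub>p, \<tau>\<^sub>1, \<bar>\<sigma>\<^sub>m\<bar>, \<bar>\<sigma>\<^sub>p\<bar>}"
  have "direct_sum_UNIV (transmission_kernel (split_coeff A) e)
      (decaying_values at_bot (split_coeff A) (absorption e \<sigma>\<^sub>m) e \<tau> \<eta> \<times>
       decaying_values at_top (split_coeff A) (absorption e \<sigma>\<^sub>p) e \<tau> \<eta>)"
    if \<eta>: "\<eta> \<in> tangential e" and "Re \<tau> > \<tau>\<^sub>0" for \<tau> \<eta>
  proof -
    from \<open>Re \<tau> > \<tau>\<^sub>0\<close> have \<tau>: "Re \<tau> > m" "Re \<tau> > m\<^sub>m" "Re \<tau> > m\<^sub>p" "Re \<tau> > \<tau>\<^sub>1" "Re \<tau> > 0"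
        "Re \<tau> > \<bar>\<sigma>\<^sub>m\<bar>" "Re \<tau> > \<bar>\<sigma>\<^sub>p\<bar>"
      using \<tau>\<^sub>1(1) by (auto simp: \<tau>\<^sub>0_def)
    then have "\<tau> \<noteq> 0" by auto
    have detM: "det (M \<tau> \<eta>) \<noteq> 0" using m \<tau>(1) by fastforce
    then obtain R where R: "M \<tau> \<eta> ** R = mat 1"
      unfolding invertible_det_nz[symmetric] invertible_def by blast
    define G where "G = R ** A e"
    have MG: "M \<tau> \<eta> ** G = A e"
      by (simp add: G_def matrix_mul_assoc R)
    have MGv: "M \<tau> \<eta> *v (G *v v) = A e *v v" for v
      by (simp add: matrix_vector_mul_assoc MG)
    have Geq: "G *v s = G *v t" if "A e *v s = A e *v t" for s t
      using that by (simp add: G_def flip: matrix_vector_mul_assoc)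
    have ss: "semisimple_at_zero G"
      unfolding semisimple_at_zero_def
    proof (intro allI impI)
      fix v assume "G *v (G *v v) = 0"
      then have "A e *v (G *v v) = 0" by (simp flip: MGv)
      \<comment> \<open>Nondegeneracy compares \<eta> with the frequency 0 at the same \<tau>, where
        the symbol reduces to \<open>mat \<tau>\<close>.\<close>
      moreover have "symbol A 0 \<tau> (\<chi> l. \<i> * complex_of_real ((0 :: real^'d) $ l)) = mat \<tau>"
        by (simp add: symbol_def)
      then have "degree (det (pencil (A e) (M \<tau> \<eta>))) = degree (det (pencil (A e) (mat \<tau>)))"
        using \<tau>\<^sub>1(2)[OF \<eta> \<tau>(4)] \<tau>\<^sub>1(2)[of 0 \<tau>, OF _ \<tau>(4)] normal_poly_pencil[OF \<eta>, of A \<tau>]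
          normal_poly_pencil[of 0 e A \<tau>]
        by (simp add: M_def \<zeta>_def tangential_def)
      ultimately show "G *v v = 0"
        using pencil_degree_kernel_range[OF semisimple \<open>\<tau> \<noteq> 0\<close> detM] MGv by metis
    qed
    define \<kappa>\<^sub>m \<kappa>\<^sub>p where "\<kappa>\<^sub>m = (\<tau> + of_real \<sigma>\<^sub>m) / \<tau>" and "\<kappa>\<^sub>p = (\<tau> + of_real \<sigma>\<^sub>p) / \<tau>"
    have "Re (\<tau> + of_real \<sigma>\<^sub>m) > 0" "Re (\<tau> + of_real \<sigma>\<^sub>p) > 0" using \<tau>(6,7) by auto
    then have \<kappa>0: "- \<kappa>\<^sub>m \<noteq> 0" "\<kappa>\<^sub>p \<noteq> 0"
      unfolding \<kappa>\<^sub>m_def \<kappa>\<^sub>p_def using \<open>\<tau> \<noteq> 0\<close> by (metis divide_eq_0_iff less_irrefl neg_equal_0_iff_equal zero_complex.sel(1))+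
    \<comment> \<open>Both \<kappa> give the sign of \<open>Re (1 / z)\<close>; the minus sign from
      \<open>at_bot\<close> assigns each nonzero eigenvalue to exactly one side.\<close>
    have sign: "(0 < Re (- \<kappa>\<^sub>m / z)) \<noteq> (0 < Re (\<kappa>\<^sub>p / z))"
      if "v \<noteq> 0" "G *v v = z *s v" "z \<noteq> 0" for v z
    proof -
      have Av: "A e *v v = z *s (M \<tau> \<eta> *v v)"
        unfolding MGv[symmetric] that(2) by (rule vector_scalar_commute)
      note sm = split_mode_sign[OF m[unfolded M_def \<zeta>_def] m\<^sub>m[unfolded \<zeta>_def] \<tau>(1,2,5) \<eta> that(1)
          Av[unfolded M_def \<zeta>_def] that(3), folded \<kappa>\<^sub>m_def]
      note sp = split_mode_sign[OF m[unfolded M_def \<zeta>_def] m\<^sub>p[unfolded \<zeta>_def] \<tau>(1,3,5) \<eta> that(1)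
          Av[unfolded M_def \<zeta>_def] that(3), folded \<kappa>\<^sub>p_def]
      have "Re (- \<kappa>\<^sub>m / z) = - Re (\<kappa>\<^sub>m / z)" by simp
      then show ?thesis using sm sp by linarith
    qed
    have E\<^sub>m: "decaying_values at_bot (split_coeff A) (absorption e \<sigma>\<^sub>m) e \<tau> \<eta> =
        block_lift A e \<tau> (\<zeta> \<eta>) ` decaying_data G (- \<kappa>\<^sub>m)"
      unfolding \<kappa>\<^sub>m_def \<zeta>_def decaying_data_at_bot
      by (rule decaying_values_split[OF \<eta> \<open>\<tau> \<noteq> 0\<close> MG[unfolded M_def \<zeta>_def] detM[unfolded M_def \<zeta>_def]])
    have E\<^sub>p: "decaying_values at_top (split_coeff A) (absorption e \<sigma>\<^sub>p) e \<tau> \<eta> =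
        block_lift A e \<tau> (\<zeta> \<eta>) ` decaying_data G \<kappa>\<^sub>p"
      unfolding \<kappa>\<^sub>p_def \<zeta>_def decaying_data_at_top
      by (rule decaying_values_split[OF \<eta> \<open>\<tau> \<noteq> 0\<close> MG[unfolded M_def \<zeta>_def] detM[unfolded M_def \<zeta>_def]])
    have "\<zeta> \<eta> $ e = 0" using \<eta> by (simp add: \<zeta>_def tangential_def)
    note block = block_sum_block_lift[OF this \<open>\<tau> \<noteq> 0\<close>, of A]
    note block_sum_diff = linear_diff[OF bounded_linear.linear[OF bounded_linear_block_sum]]
    have lift0: "block_lift A e \<tau> (\<zeta> \<eta>) 0 = 0"
      by (rule linear_0[OF bounded_linear.linear[OF bounded_linear_block_lift]])
    \<comment> \<open>Only row \<open>e\<close> of the split coefficient is nonzero, so the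
      transmission condition sees the block sums alone.\<close>
    have kernel: "(w, w') \<in> transmission_kernel (split_coeff A) e \<longleftrightarrow>
        A e *v block_sum w = A e *v block_sum w'" for w w'
    proof -
      have "split_coeff A e *v w = split_coeff A e *v w' \<longleftrightarrow>
          (\<forall>k a. (if k = e then (A e *v block_sum w) $ a else 0) = (if k = e then (A e *v block_sum w') $ a else 0))"
        by (simp only: vec_eq_iff split_paired_All split_coeff_mult)
      then show ?thesis by (auto simp: transmission_kernel_def vec_eq_iff)
    qed
    show ?thesis
      unfolding direct_sum_UNIV_def E\<^sub>m E\<^sub>p
    proof (intro conjI equalityI subsetI)
      fix x assume "x \<in> transmission_kernel (split_coeff A) e \<inter>
        block_lift A e \<tau> (\<zeta> \<eta>) ` decaying_data G (- \<kappa>\<^sub>m) \<times> block_lift A e \<tau> (\<zeta> \<eta>) ` decaying_data G \<kappa>\<^sub>p"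
      then obtain s t where x: "x = (block_lift A e \<tau> (\<zeta> \<eta>) s, block_lift A e \<tau> (\<zeta> \<eta>) t)"
        and st: "s \<in> decaying_data G (- \<kappa>\<^sub>m)" "t \<in> decaying_data G \<kappa>\<^sub>p" "A e *v s = A e *v t"
        by (auto simp: kernel block)
      have "s = 0 \<and> t = 0"
      proof (rule decaying_data_independent[OF st(1,2) Geq[OF st(3)] \<kappa>0])
        fix z v assume "v \<noteq> 0" "G *v v = z *s v"
        then show "\<not> (0 < Re (- \<kappa>\<^sub>m / z) \<and> 0 < Re (\<kappa>\<^sub>p / z))"
          using sign[of v z] by (cases "z = 0") auto
      qed
      then show "x \<in> {0}" by (simp add: x lift0 zero_prod_def)
    next
      fix x :: "(complex^('d \<times> 'n)) \<times> (complex^('d \<times> 'n))"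
      assume "x \<in> {0}"
      then show "x \<in> transmission_kernel (split_coeff A) e \<inter>
        block_lift A e \<tau> (\<zeta> \<eta>) ` decaying_data G (- \<kappa>\<^sub>m) \<times> block_lift A e \<tau> (\<zeta> \<eta>) ` decaying_data G \<kappa>\<^sub>p"
        using decaying_data_0 lift0 by (auto simp: kernel zero_prod_def image_iff intro!: bexI[of _ 0])
    next
      fix x :: "(complex^('d \<times> 'n)) \<times> (complex^('d \<times> 'n))"
      obtain g h where x: "x = (g, h)" by (cases x)
      \<comment> \<open>Only the jump of the block sums has to be matched, modulo the kernel of
        \<open>A e\<close>; subtracting the lifts of \<open>s\<close> and \<open>t\<close> from
        \<open>g\<close> and \<open>h\<close> then leaves an element of the transmission
        kernel.\<close>
      have "\<exists>s\<in>decaying_data G (- \<kappa>\<^sub>m). \<exists>t\<in>decaying_data G \<kappa>\<^sub>p. G *v block_sum (g - h) = G *v (s - t)"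
        by (rule decaying_data_complement[OF ss]) (use sign in blast)
      then obtain s t where st: "s \<in> decaying_data G (- \<kappa>\<^sub>m)" "t \<in> decaying_data G \<kappa>\<^sub>p"
        "G *v block_sum (g - h) = G *v (s - t)" by blast
      define w w' where "w = block_lift A e \<tau> (\<zeta> \<eta>) s" and "w' = block_lift A e \<tau> (\<zeta> \<eta>) t"
      have "A e *v block_sum (g - h) = A e *v (s - t)"
        by (simp only: MGv[symmetric] st(3))
      then have "A e *v block_sum (g - w) = A e *v block_sum (h - w')"
        by (simp add: block_sum_diff w_def w'_def block matrix_vector_mult_diff_distrib algebra_simps)
      then have "(g - w, h - w') \<in> transmission_kernel (split_coeff A) e"
        by (simp only: kernel)
      moreover have "x = (g - w, h - w') + (w, w')" by (simp add: x)
      ultimately show "x \<in> {x + y |x y. x \<in> transmission_kernel (split_coeff A) e \<and>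
        y \<in> block_lift A e \<tau> (\<zeta> \<eta>) ` decaying_data G (- \<kappa>\<^sub>m) \<times> block_lift A e \<tau> (\<zeta> \<eta>) ` decaying_data G \<kappa>\<^sub>p}"
        using st(1,2) w_def w'_def by blast
    qed simp
  qed
  then show ?thesis
    unfolding Hersh_condition_def by blast
qed

end
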